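(* Let $\mu = \zeta_\ell^m$ be the collapsing distribution for $\mathsf{Tribes}_{m,\ell}$ described in the context, partitioned by the auxiliary random variables $\bar{\mathbf{M}}, \bar{\mathbf{Z}}, \bar{\mathbf{W}}$. Then \[ \mathsf{IC}_\mu(\mathsf{Tribes}_{m,\ell}) \geq m \cdot \mathsf{IC}_{\zeta_\ell}(\mathsf{Disj}_\ell). \]
   Context: Setting: the $k$-processor coordinator (number-in-hand message-passing) model. There are $k$ processors, each holding a private input and private random coins, and a coordinator with no input; every processor communicates only with the coordinator over a private channel. For a protocol $\Pi$, $\Pi^i(\mathbf{X})$ denotes processor $i$'s view of the transcript (the messages exchanged between processor $i$ and the coordinator). Inputs are viewed as $k\times n$ Boolean matrices, row $i$ belonging to processor $i$. $\mathsf{Disj}_\ell$ on a $k\times\ell$ matrix outputs 1 iff some column is all ones. $\mathsf{Tribes}_{m,\ell}$ on a $k\times m\ell$ matrix, split into $m$ blocks $A_1,\dots,A_m$ of $k\times\ell$ submatrices, outputs 1 iff $\mathsf{Disj}_\ell(A_t)=1$ for every $t\in[m]$. The distribution $\zeta_\ell$ on tuples $(\mathbf{X},\mathbf{M},\mathbf{Z},\mathbf{W})$, with $\mathbf{X}$ a $k\times\ell$ input to $\mathsf{Disj}_\ell$: independently for each column $j\in[\ell]$, sample $\mathbf{M}_j\in\{0,1\}$ with $\Pr[\mathbf{M}_j=1]=1/3$ and $\mathbf{Z}_j$ uniform in $[k]$; processor $\mathbf{Z}_j$'s bit in column $j$ is $0$, and every other processor's bit in column $j$ is $1$ if $\mathbf{M}_j=1$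 and uniform in $\{0,1\}$ if $\mathbf{M}_j=0$. Then sample $\mathbf{W}$ uniform in $[\ell]$ and overwrite column $\mathbf{W}$ with all ones. Thus $\zeta_\ell$ is supported on 1-inputs of $\mathsf{Disj}_\ell$. Here $\mathbf{M}=\langle \mathbf{M}_1,\dots,\mathbf{M}_\ell\rangle$, $\mathbf{Z}=\langle\mathbf{Z}_1,\dots,\mathbf{Z}_\ell\rangle$. The distribution $\mu=\zeta_\ell^m$ on $(\bar{\mathbf{X}},\bar{\mathbf{M}},\bar{\mathbf{Z}},\bar{\mathbf{W}})$ is the $m$-fold product, one independent copy per block of $\mathsf{Tribes}_{m,\ell}$; it is collapsing for $\mathsf{Tribes}_{m,\ell}$, meaning that replacing any one block by an arbitrary $y$ makes the $\mathsf{Tribes}_{m,\ell}$ value equal $\mathsf{Disj}_\ell(y)$. Information cost of a protocol $\Pi$ with respect to such a distribution: \[ \mathsf{IC}_\mu(\Pi)=\sum_{i\in[k]}\Big(\mathbb{I}[\bar{\mathbf{X}}^i:\Pi^i(\bar{\mathbf{X}})\mid \bar{\mathbf{M}},\bar{\mathbf{Z}},\bar{\mathbf{W}}]+\mathbb{I}[\bar{\mathbf{M}}:\Pi^i(\bar{\mathbf{X}})\mid \bar{\mathbf{X}}^i,\bar{\mathbf{Z}},\bar{\mathbf{W}}]\Big), \] where $\bar{\mathbf{X}}^i$ is processor $i$'s input, and the information complexity $\mathsf{IC}_\mu(f)$ of a function $f$ is the infimum of $\mathsf{IC}_\mu(\Pi)$ over all bounded-error ($\delta$-error) protocols $\Pi$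 for $f$ (analogously for $\mathsf{IC}_{\zeta_\ell}(\mathsf{Disj}_\ell)$ with $(\mathbf{X},\mathbf{M},\mathbf{Z},\mathbf{W})\sim\zeta_\ell$). *)

theory Defs
  imports "HOL-Probability.Probability" "HOL-Library.Monad_Syntax"
begin

text \<open>
  Sizes are cardinalities of finite index types: the \<open>k\<close> processors are the elements of \<open>'k\<close>, the
  \<open>l\<close> columns of a block the elements of \<open>'l\<close>, the \<open>m\<close> blocks the elements of \<open>'m\<close>.  A family of
  inputs is a function \<open>x :: 'k \<Rightarrow> 'a\<close>, where \<open>x i\<close> is the private input of processor \<open>i\<close>; for
  Boolean matrices it is the row \<open>x i :: 'l \<Rightarrow> bool\<close>.
\<close>

subsection \<open>Protocols in the coordinator model\<close>

type_synonym msg = "bool list"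

text \<open>
  One round is an exchange on one private channel: the coordinator's message to the processor,
  and the processor's reply.
\<close>

type_synonym view = "(msg \<times> msg) list"
type_synonym 'k transcript = "('k \<times> msg \<times> msg) list"

datatype 'k action = Query 'k msg | Halt bool

text \<open>
  All parties are deterministic given their private coins.  Since only boundedly many bits are ever
  exchanged (\<open>bounded_comm\<close> below), coins drawn from an arbitrary distribution on \<open>nat\<close> are no
  restriction.
\<close>

record ('k, 'a) protocol =
  coord_coins :: "nat pmf"
  proc_coins :: "'k \<Rightarrow> nat pmf"
  coord :: "nat \<Rightarrow> 'k transcript \<Rightarrow> 'k action"
  proc :: "'k \<Rightarrow> nat \<Rightarrow> 'a \<Rightarrow> view \<Rightarrow> msg \<Rightarrow> msg"

definition view :: "'k \<Rightarrow> 'k transcript \<Rightarrow> view" where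
  "view i tr = map snd (filter (\<lambda>e. fst e = i) tr)"

type_synonym 'k coins = "nat \<times> ('k \<Rightarrow> nat)"

definition coins :: "('k::finite, 'a) protocol \<Rightarrow> 'k coins pmf" where
  "coins P = pair_pmf (coord_coins P) (Pi_pmf UNIV 0 (proc_coins P))"

fun run :: "('k, 'a) protocol \<Rightarrow> ('k \<Rightarrow> 'a) \<Rightarrow> 'k coins \<Rightarrow> nat \<Rightarrow> 'k transcript" where
  "run P x r 0 = []"
| "run P x r (Suc n) =
    (let tr = run P x r n in
      case coord P (fst r) tr of
        Halt b \<Rightarrow> tr
      | Query i q \<Rightarrow> tr @ [(i, q, proc P i (snd r i) (x i) (view i tr) q)])"

definition halted :: "('k, 'a) protocol \<Rightarrow> ('k \<Rightarrow> 'a) \<Rightarrow> 'k coins \<Rightarrow> nat \<Rightarrow> bool" where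
  "halted P x r n \<longleftrightarrow> (\<exists>b. coord P (fst r) (run P x r n) = Halt b)"

definition bounded_comm :: "('k, 'a) protocol \<Rightarrow> bool" where
  "bounded_comm P \<longleftrightarrow> (\<exists>B. \<forall>x r. halted P x r B \<and>
     (\<forall>(i, q, a) \<in> set (run P x r B). length q \<le> B \<and> length a \<le> B))"

definition transcript :: "('k, 'a) protocol \<Rightarrow> ('k \<Rightarrow> 'a) \<Rightarrow> 'k coins \<Rightarrow> 'k transcript" where
  "transcript P x r = run P x r (LEAST n. halted P x r n)"

definition outcome :: "('k, 'a) protocol \<Rightarrow> ('k \<Rightarrow> 'a) \<Rightarrow> 'k coins \<Rightarrow> bool" where
  "outcome P x r \<longleftrightarrow> coord P (fst r) (transcript P x r) = Halt True"

definition error_protocol ::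
  "real \<Rightarrow> (('k::finite \<Rightarrow> 'a) \<Rightarrow> bool) \<Rightarrow> ('k, 'a) protocol \<Rightarrow> bool" where
  "error_protocol \<delta> f P \<longleftrightarrow> bounded_comm P \<and>
     (\<forall>x. measure_pmf.prob (coins P) {r. outcome P x r \<noteq> f x} \<le> \<delta>)"

subsection \<open>Information cost\<close>

definition cond_mutual_info ::
  "'s pmf \<Rightarrow> ('s \<Rightarrow> 'a) \<Rightarrow> ('s \<Rightarrow> 'b) \<Rightarrow> ('s \<Rightarrow> 'c) \<Rightarrow> real" where
  "cond_mutual_info p X Y Z =
     prob_space.conditional_mutual_information (measure_pmf p) 2
       (count_space (range X)) (count_space (range Y)) (count_space (range Z)) X Y Z"

text \<open>The distribution \<open>\<mu>\<close> is the joint law of the input and the auxiliary variables \<open>M\<close>, \<open>Z\<close>, \<open>W\<close>.\<close>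

definition info_cost ::
  "(('k::finite \<Rightarrow> 'a) \<times> 'b \<times> 'c \<times> 'd) pmf \<Rightarrow> ('k, 'a) protocol \<Rightarrow> real" where
  "info_cost \<mu> P =
    (let p = pair_pmf \<mu> (coins P);
         X = (\<lambda>i ((x, m, z, w), r). x i);
         M = (\<lambda>((x, m, z, w), r). m);
         Z = (\<lambda>((x, m, z, w), r). z);
         W = (\<lambda>((x, m, z, w), r). w);
         V = (\<lambda>i ((x, m, z, w), r). view i (transcript P x r))
     in \<Sum>i\<in>UNIV.
          cond_mutual_info p (X i) (V i) (\<lambda>s. (M s, Z s, W s)) +
          cond_mutual_info p M (V i) (\<lambda>s. (X i s, Z s, W s)))"

definition info_complexity ::
  "real \<Rightarrow> (('k::finite \<Rightarrow> 'a) \<times> 'b \<times> 'c \<times> 'd) pmf \<Rightarrow> (('k \<Rightarrow> 'a) \<Rightarrow> bool) \<Rightarrow> real" where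
  "info_complexity \<delta> \<mu> f = (INF P \<in> {P. error_protocol \<delta> f P}. info_cost \<mu> P)"

subsection \<open>The functions and the hard distribution\<close>

definition Disj :: "('k \<Rightarrow> 'l \<Rightarrow> bool) \<Rightarrow> bool" where
  "Disj x \<longleftrightarrow> (\<exists>j. \<forall>i. x i j)"

text \<open>The columns of a Tribes input are indexed by pairs of a block and a column of that block.\<close>

definition Tribes :: "('k \<Rightarrow> 'm \<times> 'l \<Rightarrow> bool) \<Rightarrow> bool" where
  "Tribes x \<longleftrightarrow> (\<forall>t. Disj (\<lambda>i j. x i (t, j)))"

definition column_dist :: "(('k::finite \<Rightarrow> bool) \<times> bool \<times> 'k) pmf" where
  "column_dist = do {
     m \<leftarrow> bernoulli_pmf (1/3);
     z \<leftarrow> pmf_of_set UNIV;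
     c \<leftarrow> Pi_pmf UNIV False (\<lambda>i. if i = z then return_pmf False
                                else if m then return_pmf True
                                else bernoulli_pmf (1/2));
     return_pmf (c, m, z)
   }"

definition zeta ::
  "(('k::finite \<Rightarrow> 'l::finite \<Rightarrow> bool) \<times> ('l \<Rightarrow> bool) \<times> ('l \<Rightarrow> 'k) \<times> 'l) pmf" where
  "zeta = do {
     s \<leftarrow> Pi_pmf UNIV undefined (\<lambda>_. column_dist);
     w \<leftarrow> pmf_of_set UNIV;
     return_pmf (\<lambda>i j. if j = w then True else fst (s j) i,
                 \<lambda>j. fst (snd (s j)),
                 \<lambda>j. snd (snd (s j)),
                 w)
   }"

definition zeta_power ::
  "(('k::finite \<Rightarrow> 'm::finite \<times> 'l::finite \<Rightarrow> bool) \<times>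
    ('m \<Rightarrow> 'l \<Rightarrow> bool) \<times> ('m \<Rightarrow> 'l \<Rightarrow> 'k) \<times> ('m \<Rightarrow> 'l)) pmf" where
  "zeta_power = do {
     s \<leftarrow> Pi_pmf UNIV undefined (\<lambda>_. zeta);
     return_pmf (\<lambda>i (t, j). fst (s t) i j,
                 \<lambda>t. fst (snd (s t)),
                 \<lambda>t. fst (snd (snd (s t))),
                 \<lambda>t. snd (snd (snd (s t))))
   }"

end

theory Submission
  imports Defs
begin

text \<open>
  Order the blocks. A Tribes protocol \<open>P\<close> is turned into a Disj protocol for block \<open>t\<close> by hard-wiring
  \<open>M\<close> of the earlier blocks and \<open>Z\<close>, \<open>W\<close> of all other blocks. The processors sample their own rows of
  the earlier blocks; the coordinator samples \<open>M\<close> and \<open>X\<close> of the later blocks and tells each processor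
  its own rows. Averaged over the hard-wired values, processor \<open>i\<close> with view \<open>V\<close> in \<open>P\<close> pays at most
  \<open>I[X\<^sub>t : V, X\<^sub>>\<^sub>t, M\<^sub>>\<^sub>t | M\<^sub>\<le>\<^sub>t, Z, W] = I[X\<^sub>t : V | X\<^sub>>\<^sub>t, M, Z, W]\<close> and
  \<open>I[M\<^sub>t : V, X | X\<^sub>t, M\<^sub><\<^sub>t, Z, W] = I[M\<^sub>t : V | X, M\<^sub><\<^sub>t, Z, W]\<close>, both equalities by independence of the
  blocks. By the chain rule these sum over \<open>t\<close> to the two terms in the cost of \<open>P\<close>. Conditioning on
  all of \<open>M\<close> in the second term, or on all other rows in the first, would break the chain rule; this
  is why earlier and later blocks are treated differently.
\<close>

section \<open>Entropy of finitely supported distributions\<close>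

text \<open>Over an infinite support the sum defaults to 0, so the value is the Shannon entropy in
  bits only for finite supports.\<close>

definition ent :: "'a pmf \<Rightarrow> real" where
  "ent p = - (\<Sum>x\<in>set_pmf p. pmf p x * log 2 (pmf p x))"

lemma sum_pmf_map:
  assumes "finite (set_pmf p)"
  shows "(\<Sum>y\<in>set_pmf (map_pmf f p). pmf (map_pmf f p) y * g y) = (\<Sum>x\<in>set_pmf p. pmf p x * g (f x))"
proof -
  have "measure_pmf.expectation (map_pmf f p) g = (\<Sum>y\<in>f ` set_pmf p. g y * pmf (map_pmf f p) y)"
    by (rule integral_measure_pmf_real) (use assms in auto)
  moreover have "measure_pmf.expectation p (\<lambda>x. g (f x)) = (\<Sum>x\<in>set_pmf p. g (f x) * pmf p x)"
    by (rule integral_measure_pmf_real) (use assms in auto)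
  ultimately show ?thesis
    by (simp add: mult.commute)
qed

text \<open>The entropy of a marginal as an average over the full law, so that several marginal
  entropies can be combined in one sum.\<close>

lemma ent_map:
  assumes "finite (set_pmf p)"
  shows "ent (map_pmf f p) = - (\<Sum>x\<in>set_pmf p. pmf p x * log 2 (pmf (map_pmf f p) (f x)))"
  unfolding ent_def by (simp only: sum_pmf_map[OF assms])

lemma ent_map_inj:
  assumes "inj_on f (set_pmf p)"
  shows "ent (map_pmf f p) = ent p"
  unfolding ent_def set_map_pmf
  by (subst sum.reindex) (auto simp: assms pmf_map_inj intro!: sum.cong)

text \<open>Entropy sees only which samples a variable separates. Tuples carrying the same
  information in another arrangement are identified in this way throughout.\<close>

lemma ent_map_cong:
  assumes "\<And>s s'. X s = X s' \<longleftrightarrow> Y s = Y s'"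
  shows "ent (map_pmf X p) = ent (map_pmf Y p)"
proof -
  \<comment> \<open>\<open>inv Y\<close> picks one sample with the given value of \<open>Y\<close>;
    by assumption \<open>X\<close> does not depend on the choice.\<close>
  define f where "f = (\<lambda>y. X (inv Y y))"
  have f: "f (Y s) = X s" for s
    unfolding f_def by (metis assms f_inv_into_f rangeI)
  have "map_pmf X p = map_pmf f (map_pmf Y p)"
    by (simp add: pmf.map_comp o_def f)
  moreover have "inj_on f (set_pmf (map_pmf Y p))"
    by (auto simp: inj_on_def f assms)
  ultimately show ?thesis
    by (simp add: ent_map_inj)
qed

section \<open>Conditional mutual information as a combination of entropies\<close>

lemma finite_range_Pair:
  assumes "finite (range f)" "finite (range g)"
  shows "finite (range (\<lambda>s. (f s, g s)))"
  by (rule finite_subset[OF _ finite_cartesian_product[OF assms]]) auto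

text \<open>Finite ranges make the measure-theoretic definition, which is a difference of integrals, meaningful.\<close>

lemma cond_mutual_info_eq_ent:
  fixes X :: "'s \<Rightarrow> 'b" and Y :: "'s \<Rightarrow> 'c" and Z :: "'s \<Rightarrow> 'd"
  assumes "finite (range X)" "finite (range Y)" "finite (range Z)"
  shows "cond_mutual_info p X Y Z =
    ent (map_pmf (\<lambda>s. (X s, Z s)) p) + ent (map_pmf (\<lambda>s. (Y s, Z s)) p)
    - ent (map_pmf (\<lambda>s. (X s, Y s, Z s)) p) - ent (map_pmf Z p)"
proof -
  interpret information_space "measure_pmf p" 2
    by unfold_locales auto
  have sf: "simple_function (measure_pmf p) f" if "finite (range f)" for f :: "_ \<Rightarrow> 'z"
    using that by (auto simp: simple_function_def)
  have sd: "simple_distributed (measure_pmf p) f (pmf (map_pmf f p))" if "finite (range f)"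
    for f :: "_ \<Rightarrow> 'z"
    by (rule measure_pmf.simple_distributedI[OF sf[OF that]]) (auto simp: pmf_map)
  have fin: "finite (range (\<lambda>s. (X s, Y s, Z s)))" "finite (range (\<lambda>s. (X s, Z s)))"
    "finite (range (\<lambda>s. (Y s, Z s)))"
    by (intro finite_range_Pair assms)+
  define q where "q = map_pmf (\<lambda>s. (X s, Y s, Z s)) p"
  have q: "finite (set_pmf q)"
    using finite_subset[OF image_mono[OF subset_UNIV] fin(1)] by (simp add: q_def)
  define fxz where "fxz = (\<lambda>(x :: 'b, y :: 'c, z :: 'd). (x, z))"
  define fyz where "fyz = (\<lambda>(x :: 'b, y :: 'c, z :: 'd). (y, z))"
  define fz where "fz = (\<lambda>(x :: 'b, y :: 'c, z :: 'd). z)"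
  have maps: "map_pmf (\<lambda>s. (X s, Z s)) p = map_pmf fxz q" "map_pmf (\<lambda>s. (Y s, Z s)) p = map_pmf fyz q"
    "map_pmf Z p = map_pmf fz q"
    by (simp_all add: q_def pmf.map_comp o_def fxz_def fyz_def fz_def)
  have pos: "pmf (map_pmf f q) (f v) > 0" if "v \<in> set_pmf q" for f :: "_ \<Rightarrow> 'z" and v
    using that by (simp add: pmf_positive_iff)
  let ?l = "log 2"
  have "cond_mutual_info p X Y Z = (\<Sum>(x, y, z)\<in>range (\<lambda>s. (X s, Y s, Z s)).
      pmf q (x, y, z) * ?l (pmf q (x, y, z) / (pmf (map_pmf fxz q) (x, z) *
        (pmf (map_pmf fyz q) (y, z) / pmf (map_pmf fz q) z))))"
    unfolding cond_mutual_info_def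
    using conditional_mutual_information_eq[OF sd[OF assms(3)] sd[OF fin(3)] sd[OF fin(2)] sd[OF fin(1)]]
    by (simp add: maps flip: q_def)
  also have "\<dots> = (\<Sum>v\<in>range (\<lambda>s. (X s, Y s, Z s)).
      pmf q v * ?l (pmf q v / (pmf (map_pmf fxz q) (fxz v) *
        (pmf (map_pmf fyz q) (fyz v) / pmf (map_pmf fz q) (fz v)))))"
    by (auto intro!: sum.cong simp: fxz_def fyz_def fz_def)
  \<comment> \<open>Terms off the support vanish through the factor \<open>pmf q v\<close>; on the
    support all marginals are positive, so the logarithm of the quotient will split.\<close>
  also have "\<dots> = (\<Sum>v\<in>set_pmf q.
      pmf q v * ?l (pmf q v / (pmf (map_pmf fxz q) (fxz v) *
        (pmf (map_pmf fyz q) (fyz v) / pmf (map_pmf fz q) (fz v)))))"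
  proof (rule sum.mono_neutral_right[OF fin(1)])
    show "set_pmf q \<subseteq> range (\<lambda>s. (X s, Y s, Z s))"
      by (auto simp: q_def)
  qed (simp add: pmf_eq_0_set_pmf)
  also have "\<dots> = (\<Sum>v\<in>set_pmf q. pmf q v * ?l (pmf q v)
      - pmf q v * ?l (pmf (map_pmf fxz q) (fxz v)) - pmf q v * ?l (pmf (map_pmf fyz q) (fyz v))
      + pmf q v * ?l (pmf (map_pmf fz q) (fz v)))"
  proof (rule sum.cong[OF refl])
    fix v assume v: "v \<in> set_pmf q"
    show "pmf q v * ?l (pmf q v / (pmf (map_pmf fxz q) (fxz v) *
        (pmf (map_pmf fyz q) (fyz v) / pmf (map_pmf fz q) (fz v)))) = pmf q v * ?l (pmf q v)
      - pmf q v * ?l (pmf (map_pmf fxz q) (fxz v)) - pmf q v * ?l (pmf (map_pmf fyz q) (fyz v))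
      + pmf q v * ?l (pmf (map_pmf fz q) (fz v))"
      using pos[OF v, of fxz] pos[OF v, of fyz] pos[OF v, of fz] pmf_positive[OF v]
      by (simp add: log_divide log_mult algebra_simps)
  qed
  also have "\<dots> = ent (map_pmf fxz q) + ent (map_pmf fyz q) - ent q - ent (map_pmf fz q)"
    unfolding ent_map[OF q] ent_def[of q] by (simp add: sum.distrib sum_subtractf)
  finally show ?thesis
    by (simp add: maps flip: q_def)
qed

lemma cond_mutual_info_nonneg:
  assumes "finite (range X)" "finite (range Y)" "finite (range Z)"
  shows "0 \<le> cond_mutual_info p X Y Z"
proof -
  interpret information_space "measure_pmf p" 2
    by unfold_locales auto
  show ?thesis
    using conditional_mutual_information_nonneg[of X Y Z] assms
    by (simp add: cond_mutual_info_def simple_function_def)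
qed

text \<open>Chain rule: \<open>I[X : Y | Z] = I[X : f(Y) | Z] + I[X : Y | f(Y), Z]\<close>, and the
  last term is nonnegative. In the entropies, a redundant \<open>f (Y s)\<close> next to
  \<open>Y s\<close> drops out.\<close>

lemma cond_mutual_info_data_processing:
  assumes "finite (range X)" "finite (range Y)" "finite (range Z)"
  shows "cond_mutual_info p X (\<lambda>s. f (Y s)) Z \<le> cond_mutual_info p X Y Z"
proof -
  have fY: "finite (range (\<lambda>s. f (Y s)))"
    using finite_imageI[OF assms(2), of f] by (simp add: image_image)
  have fYZ: "finite (range (\<lambda>s. (f (Y s), Z s)))"
    by (rule finite_range_Pair[OF fY assms(3)])
  have "0 \<le> cond_mutual_info p X Y (\<lambda>s. (f (Y s), Z s))"
    by (rule cond_mutual_info_nonneg[OF assms(1,2) fYZ])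
  moreover have "ent (map_pmf (\<lambda>s. (Y s, f (Y s), Z s)) p) = ent (map_pmf (\<lambda>s. (Y s, Z s)) p)"
    "ent (map_pmf (\<lambda>s. (X s, Y s, f (Y s), Z s)) p) = ent (map_pmf (\<lambda>s. (X s, Y s, Z s)) p)"
    by (rule ent_map_cong, auto)+
  ultimately show ?thesis
    by (simp add: cond_mutual_info_eq_ent assms fY fYZ)
qed

text \<open>All four entropies belong to marginals of the law of the triple, so the two sides may
  live on different sample spaces. This carries information in the embedded protocols over to
  \<open>P\<close>.\<close>

lemma cond_mutual_info_cong_law:
  assumes "finite (range X)" "finite (range Y)" "finite (range Z)"
    and "finite (range X')" "finite (range Y')" "finite (range Z')"
    and law: "map_pmf (\<lambda>s. (X s, Y s, Z s)) p = map_pmf (\<lambda>s. (X' s, Y' s, Z' s)) p'"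
  shows "cond_mutual_info p X Y Z = cond_mutual_info p' X' Y' Z'"
proof -
  have "map_pmf (\<lambda>s. g (X s, Y s, Z s)) p = map_pmf (\<lambda>s. g (X' s, Y' s, Z' s)) p'" for g :: "_ \<Rightarrow> 'z"
    using arg_cong[OF law, of "map_pmf g"] by (simp add: pmf.map_comp o_def)
  from this[of "\<lambda>(x, y, z). (x, z)"] this[of "\<lambda>(x, y, z). (y, z)"] this[of "\<lambda>(x, y, z). z"] law
  show ?thesis
    by (simp add: cond_mutual_info_eq_ent assms)
qed

section \<open>Entropy of mixtures and of product distributions\<close>

text \<open>Chain rule \<open>H(D, Y) = H(D) + H(Y | D)\<close>: the tag \<open>d\<close> stays in
  the outcome, so the components have disjoint supports and each probability is a product.\<close>

lemma ent_bind_tagged: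
  assumes "finite (set_pmf D)" and "\<And>d. d \<in> set_pmf D \<Longrightarrow> finite (set_pmf (r d))"
  shows "ent (bind_pmf D (\<lambda>d. map_pmf (Pair d) (r d))) = ent D + (\<Sum>d\<in>set_pmf D. pmf D d * ent (r d))"
proof -
  let ?p = "bind_pmf D (\<lambda>d. map_pmf (Pair d) (r d))"
  have set: "set_pmf ?p = Sigma (set_pmf D) (\<lambda>d. set_pmf (r d))"
    by auto
  have pmf: "pmf ?p (d, y) = pmf D d * pmf (r d) y" for d y
  proof -
    have eq: "pmf (map_pmf (Pair d') (r d')) (d, y) = (if d' = d then pmf (r d) y else 0)" for d'
    proof (cases "d' = d")
      case True
      then show ?thesis
        using pmf_map_inj'[of "Pair d" "r d" y] by (simp add: inj_def)
    next
      case False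
      then have "(d, y) \<notin> set_pmf (map_pmf (Pair d') (r d'))" by auto
      then show ?thesis using False by (simp add: pmf_eq_0_set_pmf)
    qed
    have "pmf ?p (d, y) = (\<Sum>d'\<in>set_pmf D. pmf D d' * (if d' = d then pmf (r d) y else 0))"
      unfolding pmf_bind eq using assms(1)
      by (subst integral_measure_pmf_real[where A = "set_pmf D"]) (auto intro!: sum.cong)
    also have "\<dots> = (\<Sum>d'\<in>set_pmf D. if d' = d then pmf D d * pmf (r d) y else 0)"
      by (intro sum.cong) auto
    also have "\<dots> = pmf D d * pmf (r d) y"
      using assms(1) by (auto simp: pmf_eq_0_set_pmf)
    finally show ?thesis .
  qed
  have "ent ?p = - (\<Sum>d\<in>set_pmf D. \<Sum>y\<in>set_pmf (r d). pmf D d * pmf (r d) y * log 2 (pmf D d * pmf (r d) y))"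
    unfolding ent_def set using assms by (subst sum.Sigma) (auto simp: pmf intro!: sum.cong)
  also have "(\<Sum>d\<in>set_pmf D. \<Sum>y\<in>set_pmf (r d). pmf D d * pmf (r d) y * log 2 (pmf D d * pmf (r d) y)) =
    (\<Sum>d\<in>set_pmf D. pmf D d * log 2 (pmf D d) - pmf D d * ent (r d))"
  proof (rule sum.cong[OF refl])
    fix d assume d: "d \<in> set_pmf D"
    have "(\<Sum>y\<in>set_pmf (r d). pmf D d * pmf (r d) y * log 2 (pmf D d * pmf (r d) y)) =
      (\<Sum>y\<in>set_pmf (r d). pmf D d * log 2 (pmf D d) * pmf (r d) y
        + pmf D d * (pmf (r d) y * log 2 (pmf (r d) y)))"
      by (intro sum.cong refl) (auto simp: log_mult pmf_positive d algebra_simps set_pmf_iff)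
    also have "\<dots> = pmf D d * log 2 (pmf D d) * (\<Sum>y\<in>set_pmf (r d). pmf (r d) y)
        + pmf D d * (\<Sum>y\<in>set_pmf (r d). pmf (r d) y * log 2 (pmf (r d) y))"
      by (simp only: sum.distrib sum_distrib_left)
    also have "(\<Sum>y\<in>set_pmf (r d). pmf (r d) y) = 1"
      using assms(2)[OF d] by (simp add: sum_pmf_eq_1)
    finally show "(\<Sum>y\<in>set_pmf (r d). pmf D d * pmf (r d) y * log 2 (pmf D d * pmf (r d) y)) =
      pmf D d * log 2 (pmf D d) - pmf D d * ent (r d)"
      by (simp add: ent_def)
  qed
  finally show ?thesis
    by (simp add: ent_def[of D] sum_subtractf)
qed

lemma ent_pair_pmf:
  assumes "finite (set_pmf p)" "finite (set_pmf q)"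
  shows "ent (pair_pmf p q) = ent p + ent q"
proof -
  have "pair_pmf p q = bind_pmf p (\<lambda>x. map_pmf (Pair x) q)"
    by (simp add: pair_pmf_def map_pmf_def)
  moreover have "(\<Sum>x\<in>set_pmf p. pmf p x * ent q) = ent q"
    using assms(1) by (simp add: sum_pmf_eq_1 flip: sum_distrib_right)
  ultimately show ?thesis
    using assms by (simp add: ent_bind_tagged)
qed

lemma map_pmf_Pi_pmf_UNIV:
  fixes p :: "'i::finite \<Rightarrow> 'a pmf"
  shows "map_pmf (\<lambda>h i. f i (h i)) (Pi_pmf UNIV d p) = Pi_pmf UNIV d' (\<lambda>i. map_pmf (f i) (p i))"
  unfolding map_pmf_def by (subst Pi_pmf_bind[where d' = d]) simp_all

lemma ent_Pi_pmf:
  assumes "finite A" "\<And>x. x \<in> A \<Longrightarrow> finite (set_pmf (p x))"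
  shows "ent (Pi_pmf A d p) = (\<Sum>x\<in>A. ent (p x))"
  using assms
proof (induction A rule: finite_induct)
  case empty
  then show ?case by (simp add: ent_def)
next
  case (insert a A)
  have fin: "finite (set_pmf (Pi_pmf A d p))"
    using insert by (simp add: set_Pi_pmf finite_PiE_dflt)
  \<comment> \<open>On the support \<open>f a\<close> is the default \<open>d\<close>, so
    overwriting at \<open>a\<close> loses nothing.\<close>
  have "inj_on (\<lambda>(y, f). f(a := y)) (set_pmf (pair_pmf (p a) (Pi_pmf A d p)))"
  proof (rule inj_onI, clarify)
    fix y f y' f'
    assume "(y, f) \<in> set_pmf (pair_pmf (p a) (Pi_pmf A d p))"
      "(y', f') \<in> set_pmf (pair_pmf (p a) (Pi_pmf A d p))" and eq: "f(a := y) = f'(a := y')"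
    then have "f a = f' a"
      using set_Pi_pmf_subset[OF insert.hyps(1), of d p] insert.hyps(2) by auto
    with eq show "y = y' \<and> f = f'"
      by (metis fun_upd_same fun_upd_triv fun_upd_upd)
  qed
  then show ?case
    using insert fin by (simp add: Pi_pmf_insert ent_map_inj ent_pair_pmf)
qed

lemma finite_range_case_prod:
  fixes F :: "'d::finite \<Rightarrow> 's \<Rightarrow> 'a"
  assumes "\<And>d. finite (range (F d))"
  shows "finite (range (\<lambda>(d, s). F d s))"
  by (rule finite_subset[of _ "\<Union>d. range (F d)"]) (auto simp: assms)

text \<open>An average over \<open>d\<close> is information conditioned on \<open>d\<close>: tagging
  turns each averaged entropy into a joint one minus \<open>ent D\<close>, and the four copies of
  \<open>ent D\<close> cancel. The variables may depend on \<open>d\<close>, as the views of a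
  protocol with hard-wired \<open>d\<close> do.\<close>

lemma sum_cond_mutual_info:
  fixes D :: "'d::finite pmf"
  assumes "\<And>d. finite (range (X d))" "\<And>d. finite (range (Y d))" "\<And>d. finite (range (Z d))"
  shows "(\<Sum>d\<in>UNIV. pmf D d * cond_mutual_info (q d) (X d) (Y d) (Z d)) =
    cond_mutual_info (bind_pmf D (\<lambda>d. map_pmf (Pair d) (q d)))
      (\<lambda>(d, s). X d s) (\<lambda>(d, s). Y d s) (\<lambda>(d, s). (d, Z d s))"
proof -
  let ?p = "bind_pmf D (\<lambda>d. map_pmf (Pair d) (q d))"
  have tag: "(\<Sum>d\<in>UNIV. pmf D d * ent (map_pmf (F d) (q d))) = ent (map_pmf (\<lambda>(d, s). (d, F d s)) ?p) - ent D"
    if "\<And>d. finite (range (F d))" for F :: "'d \<Rightarrow> _ \<Rightarrow> 'z"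
  proof -
    have "map_pmf (\<lambda>(d, s). (d, F d s)) ?p = bind_pmf D (\<lambda>d. map_pmf (Pair d) (map_pmf (F d) (q d)))"
      by (simp add: map_bind_pmf pmf.map_comp o_def)
    moreover have "ent \<dots> = ent D + (\<Sum>d\<in>set_pmf D. pmf D d * ent (map_pmf (F d) (q d)))"
      using that by (intro ent_bind_tagged) (auto intro: finite_subset[of _ "range (F _)"])
    moreover have "(\<Sum>d\<in>set_pmf D. pmf D d * ent (map_pmf (F d) (q d))) =
        (\<Sum>d\<in>UNIV. pmf D d * ent (map_pmf (F d) (q d)))"
      by (intro sum.mono_neutral_left) (auto simp: set_pmf_iff)
    ultimately show ?thesis by simp
  qed
  note finYZ = finite_range_Pair[OF assms(2,3)]
  note finXZ = finite_range_Pair[OF assms(1,3)]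
  note finXYZ = finite_range_Pair[OF assms(1) finYZ]
  have "(\<Sum>d\<in>UNIV. pmf D d * cond_mutual_info (q d) (X d) (Y d) (Z d)) =
      (\<Sum>d\<in>UNIV. pmf D d * ent (map_pmf (\<lambda>s. (X d s, Z d s)) (q d)))
      + (\<Sum>d\<in>UNIV. pmf D d * ent (map_pmf (\<lambda>s. (Y d s, Z d s)) (q d)))
      - (\<Sum>d\<in>UNIV. pmf D d * ent (map_pmf (\<lambda>s. (X d s, Y d s, Z d s)) (q d)))
      - (\<Sum>d\<in>UNIV. pmf D d * ent (map_pmf (Z d) (q d)))"
    by (simp add: cond_mutual_info_eq_ent assms algebra_simps sum.distrib sum_subtractf)
  also have "\<dots> = ent (map_pmf (\<lambda>(d, s). (d, X d s, Z d s)) ?p) + ent (map_pmf (\<lambda>(d, s). (d, Y d s, Z d s)) ?p)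
      - ent (map_pmf (\<lambda>(d, s). (d, X d s, Y d s, Z d s)) ?p) - ent (map_pmf (\<lambda>(d, s). (d, Z d s)) ?p)"
    using tag[of "\<lambda>d s. (X d s, Z d s)", OF finXZ] tag[of "\<lambda>d s. (Y d s, Z d s)", OF finYZ]
      tag[of "\<lambda>d s. (X d s, Y d s, Z d s)", OF finXYZ] tag[of Z, OF assms(3)]
    by simp
  also have "\<dots> = cond_mutual_info ?p (\<lambda>(d, s). X d s) (\<lambda>(d, s). Y d s) (\<lambda>(d, s). (d, Z d s))"
  proof -
    have finZ: "finite (range (\<lambda>(d, s). (d, Z d s)))"
      by (rule finite_range_case_prod, rule finite_subset[OF _ finite_cartesian_product[OF _ assms(3)]])
         auto
    show ?thesis
      by (subst cond_mutual_info_eq_ent[OF finite_range_case_prod finite_range_case_prod finZ])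
         (auto simp: assms intro!: arg_cong2[where f = "(+)"] arg_cong2[where f = "(-)"] ent_map_cong)
  qed
  finally show ?thesis .
qed

section \<open>Simulating a protocol with advice\<close>

lemma run_stable:
  assumes "halted P x r n" "n \<le> n'"
  shows "run P x r n' = run P x r n"
  using assms(2)
proof (induction n' rule: dec_induct)
  case (step k)
  with assms(1) show ?case
    by (auto simp: halted_def Let_def)
qed simp

text \<open>A transcript can be read off at any halting time, such as the uniform bound in
  \<open>bounded_comm\<close>.\<close>

lemma halted_Least:
  assumes "halted P x r n"
  shows "halted P x r (LEAST k. halted P x r k)" "transcript P x r = run P x r n"
proof -
  show *: "halted P x r (LEAST k. halted P x r k)"
    using assms by (rule LeastI)
  show "transcript P x r = run P x r n"
    unfolding transcript_def using run_stable[OF * Least_le[of "halted P x r", OF assms]] by simp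
qed

lemma length_run: "length (run P x r n) \<le> n"
  by (induction n) (auto simp: Let_def split: action.split)

text \<open>At most \<open>B\<close> rounds, each with two words of length at most \<open>B\<close>,
  leave finitely many views although the coins range over an infinite set.\<close>

lemma finite_views:
  fixes P :: "('k, 'a) protocol"
  assumes "bounded_comm P"
  shows "finite (\<Union>x r. {view i (transcript P x r)})"
proof -
  obtain B where B: "\<And>x r. halted P x r B"
    "\<And>x r i q a. (i, q, a) \<in> set (run P x r B) \<Longrightarrow> length q \<le> B \<and> length a \<le> B"
    using assms unfolding bounded_comm_def by fast
  let ?m = "{l :: bool list. set l \<subseteq> UNIV \<and> length l \<le> B}"
  let ?V = "{v. set v \<subseteq> ?m \<times> ?m \<and> length v \<le> B}"
  have "view i (transcript P x r) \<in> ?V" for x r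
  proof -
    have "length (view i (run P x r B)) \<le> B"
      unfolding view_def length_map by (rule order_trans[OF length_filter_le length_run])
    moreover have "set (view i (run P x r B)) \<subseteq> ?m \<times> ?m"
      by (auto simp: view_def dest!: B(2))
    ultimately show ?thesis
      by (simp add: halted_Least(2)[OF B(1)])
  qed
  moreover have "finite ?V"
    by (intro finite_lists_length_le finite_cartesian_product) simp_all
  ultimately show ?thesis
    by (elim finite_subset[rotated]) blast
qed

lemma finite_range_view:
  assumes "bounded_comm P"
  shows "finite (range (\<lambda>s. view i (transcript P (f s) (g s))))"
  by (rule finite_subset[OF _ finite_views[OF assms, of i]]) auto

text \<open>
  In \<open>simulate L U R adv inp P\<close> the coordinator draws \<open>u\<close> from \<open>U\<close> and prefixes every query to
  processor \<open>i\<close> with the advice \<open>adv u i\<close>, a word of length \<open>L\<close>. Processor \<open>i\<close> draws \<open>b\<close> from \<open>R\<close>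
  and plays \<open>P\<close> on the input which \<open>inp\<close> assembles from \<open>b\<close>, the advice and its own input.
\<close>

definition simulate :: "nat \<Rightarrow> 'u::countable pmf \<Rightarrow> 'b::countable pmf \<Rightarrow> ('u \<Rightarrow> 'k \<Rightarrow> msg) \<Rightarrow>
    ('k \<Rightarrow> 'b \<Rightarrow> msg \<Rightarrow> 'y \<Rightarrow> 'a) \<Rightarrow> ('k, 'a) protocol \<Rightarrow> ('k, 'y) protocol" where
  "simulate L U R adv inp P = \<lparr>
     coord_coins = map_pmf to_nat (pair_pmf (coord_coins P) U),
     proc_coins = (\<lambda>i. map_pmf to_nat (pair_pmf (proc_coins P i) R)),
     coord = (\<lambda>c tr. case from_nat c of (c', u) \<Rightarrow>
       (case coord P c' (map (\<lambda>(i, q, a). (i, drop L q, a)) tr) of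
          Halt b \<Rightarrow> Halt b
        | Query i q \<Rightarrow> Query i (adv u i @ q))),
     proc = (\<lambda>i c y v q. case from_nat c of (c', b) \<Rightarrow>
       proc P i c' (inp i b (take L q) y) (map (\<lambda>(q, a). (drop L q, a)) v) (drop L q)) \<rparr>"

text \<open>A party's coins are a single natural number, into which the simulation packs the coins
  of \<open>P\<close> and its own draw by \<open>to_nat\<close>. Decoding gives the coins of
  \<open>P\<close>, the coordinator's draw and the processors' draws.\<close>

definition sim_coins :: "'k coins \<Rightarrow> 'k coins \<times> 'u::countable \<times> ('k \<Rightarrow> 'b::countable)" where
  "sim_coins r = (case from_nat (fst r) of (c, u) \<Rightarrow>
     ((c, \<lambda>i. fst (from_nat (snd r i) :: nat \<times> 'b)), u, \<lambda>i. snd (from_nat (snd r i) :: nat \<times> 'b)))"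

text \<open>\<open>from_nat\<close> undoes \<open>to_nat\<close>, and a product over the processors
  of pairs is a pair of products. The default \<open>d\<close> is arbitrary because the index set is
  \<open>UNIV\<close>.\<close>

lemma map_pmf_sim_coins:
  fixes P :: "('k::finite, 'a) protocol" and U :: "'u::countable pmf" and R :: "'b::countable pmf"
  shows "map_pmf sim_coins (coins (simulate L U R adv inp P)) =
    pair_pmf (coins P) (pair_pmf U (Pi_pmf UNIV d (\<lambda>_. R)))"
proof -
  let ?dec = "\<lambda>n. from_nat n :: nat \<times> 'b"
  have "map_pmf (\<lambda>h i. ?dec (h i)) (Pi_pmf UNIV 0 (\<lambda>i. map_pmf to_nat (pair_pmf (proc_coins P i) R))) =
      Pi_pmf UNIV undefined (\<lambda>i. map_pmf ?dec (map_pmf to_nat (pair_pmf (proc_coins P i) R)))"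
    by (rule map_pmf_Pi_pmf_UNIV)
  also have "\<dots> = Pi_pmf UNIV undefined (\<lambda>i. do {c \<leftarrow> proc_coins P i; b \<leftarrow> R; return_pmf (c, b)})"
    by (simp add: pmf.map_comp o_def pair_pmf_def)
  also have "\<dots> = do {c \<leftarrow> Pi_pmf UNIV 0 (proc_coins P); b \<leftarrow> Pi_pmf UNIV d (\<lambda>_. R); return_pmf (\<lambda>i. (c i, b i))}"
    by (subst Pi_pmf_bind[where d' = 0], simp, subst Pi_pmf_bind[where d' = d], simp_all)
  finally have proc: "map_pmf (\<lambda>h i. ?dec (h i)) (Pi_pmf UNIV 0 (\<lambda>i. map_pmf to_nat (pair_pmf (proc_coins P i) R))) = \<dots>" .
  define F where "F = (\<lambda>(n, h). case from_nat n of (c, u) \<Rightarrow> ((c :: nat, \<lambda>i :: 'k. fst (h i) :: nat), u :: 'u, \<lambda>i. snd (h i) :: 'b))"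
  have "map_pmf sim_coins (coins (simulate L U R adv inp P)) =
     do {n \<leftarrow> map_pmf to_nat (pair_pmf (coord_coins P) U);
         h \<leftarrow> map_pmf (\<lambda>h i. ?dec (h i)) (Pi_pmf UNIV 0 (\<lambda>i. map_pmf to_nat (pair_pmf (proc_coins P i) R)));
         return_pmf (F (n, h))}"
    by (simp add: coins_def simulate_def pair_pmf_def map_bind_pmf bind_map_pmf sim_coins_def F_def split_beta)
  also have "\<dots> = do {c \<leftarrow> coord_coins P; u \<leftarrow> U; h \<leftarrow> Pi_pmf UNIV 0 (proc_coins P);
      b \<leftarrow> Pi_pmf UNIV d (\<lambda>_. R); return_pmf ((c, h), u, b)}"
    unfolding proc
    by (simp add: bind_map_pmf pair_pmf_def bind_assoc_pmf bind_return_pmf F_def)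
  also have "\<dots> = do {c \<leftarrow> coord_coins P; h \<leftarrow> Pi_pmf UNIV 0 (proc_coins P); u \<leftarrow> U;
      b \<leftarrow> Pi_pmf UNIV d (\<lambda>_. R); return_pmf ((c, h), u, b)}"
    by (subst bind_commute_pmf[of U]) simp
  also have "\<dots> = pair_pmf (coins P) (pair_pmf U (Pi_pmf UNIV d (\<lambda>_. R)))"
    by (simp add: coins_def pair_pmf_def bind_assoc_pmf bind_return_pmf)
  finally show ?thesis .
qed

text \<open>The coordinator strips the advice from the recorded queries and a processor strips it
  from its view, which is possible because all advice has length \<open>L\<close>. Hence the
  simulation stays in step with \<open>P\<close> on \<open>x\<close> for every \<open>n\<close>, and
  both have the same halting times.\<close>

lemma run_simulate:
  fixes P :: "('k, 'a) protocol" and U :: "'u::countable pmf" and R :: "'b::countable pmf"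
    and inp :: "'k \<Rightarrow> 'b \<Rightarrow> msg \<Rightarrow> 'y \<Rightarrow> 'a" and y :: "'k \<Rightarrow> 'y"
  assumes len: "\<And>u i. length (adv u i) = L"
    and r: "sim_coins r = (r', u, b)"
  defines "x \<equiv> \<lambda>i. inp i (b i) (adv u i) (y i)"
  shows "run (simulate L U R adv inp P) y r n = map (\<lambda>(i, q, a). (i, adv u i @ q, a)) (run P x r' n)"
    and "halted (simulate L U R adv inp P) y r n \<longleftrightarrow> halted P x r' n"
    and "coord (simulate L U R adv inp P) (fst r) (run (simulate L U R adv inp P) y r n) = Halt h
      \<longleftrightarrow> coord P (fst r') (run P x r' n) = Halt h"
proof -
  let ?S = "simulate L U R adv inp P"
  let ?add = "\<lambda>(i, q, a). (i, adv u i @ q, a)"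
  let ?strip = "\<lambda>(i, q, a). (i, drop L q, a)"
  have strip: "map ?strip (map ?add tr) = tr" for tr :: "'k transcript"
    by (rule map_idI[of tr "?strip \<circ> ?add", unfolded map_map[symmetric]]) (auto simp: len)
  have c: "from_nat (fst r) = (fst r', u)"
    using r by (auto simp: sim_coins_def split: prod.splits)
  have p: "from_nat (snd r i) = (snd r' i, b i)" for i
    using r by (auto simp: sim_coins_def split: prod.splits)
  have view: "map (\<lambda>(q, a). (drop L q, a)) (view i (map ?add tr)) = view i tr" for i tr
    by (induction tr) (auto simp: view_def len)
  have coord: "coord ?S (fst r) (map ?add tr) =
      (case coord P (fst r') tr of Halt b \<Rightarrow> Halt b | Query i q \<Rightarrow> Query i (adv u i @ q))" for tr
    by (simp add: simulate_def c strip del: map_map)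
  have proc: "proc ?S i (snd r i) (y i) (view i (map ?add tr)) (adv u i @ q) =
      proc P i (snd r' i) (x i) (view i tr) q" for i q tr
    by (simp add: simulate_def p view len x_def del: map_map)
  show run: "run ?S y r n = map ?add (run P x r' n)" for n
    by (induction n) (auto simp: Let_def coord proc split: action.split)
  show "halted ?S y r n \<longleftrightarrow> halted P x r' n"
    by (auto simp: halted_def run coord split: action.splits)
  show "coord ?S (fst r) (run ?S y r n) = Halt h \<longleftrightarrow> coord P (fst r') (run P x r' n) = Halt h"
    by (auto simp: run coord split: action.splits)
qed

context
  fixes P :: "('k, 'a) protocol" and U :: "'u::countable pmf" and R :: "'b::countable pmf"
    and L :: nat and adv :: "'u \<Rightarrow> 'k \<Rightarrow> msg" and inp :: "'k \<Rightarrow> 'b \<Rightarrow> msg \<Rightarrow> 'y \<Rightarrow> 'a"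
  assumes len: "\<And>u i. length (adv u i) = L"
begin

lemma transcript_simulate:
  assumes "sim_coins r = (r', u, b)"
  shows "transcript (simulate L U R adv inp P) y r =
    map (\<lambda>(i, q, a). (i, adv u i @ q, a)) (transcript P (\<lambda>i. inp i (b i) (adv u i) (y i)) r')"
  by (simp add: transcript_def run_simulate[OF len assms])

lemma view_simulate:
  assumes "sim_coins r = (r', u, b)"
  shows "view i (transcript (simulate L U R adv inp P) y r) =
    map (\<lambda>(q, a). (adv u i @ q, a)) (view i (transcript P (\<lambda>i. inp i (b i) (adv u i) (y i)) r'))"
proof -
  have "view i (map (\<lambda>(i, q, a). (i, adv u i @ q, a)) tr) = map (\<lambda>(q, a). (adv u i @ q, a)) (view i tr)" for tr
    by (induction tr) (auto simp: view_def)
  then show ?thesis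
    by (simp add: transcript_simulate[OF assms])
qed

lemma outcome_simulate:
  assumes "sim_coins r = (r', u, b)"
  shows "outcome (simulate L U R adv inp P) y r \<longleftrightarrow> outcome P (\<lambda>i. inp i (b i) (adv u i) (y i)) r'"
  by (simp add: outcome_def transcript_def run_simulate(2,3)[OF len assms])

lemma bounded_comm_simulate:
  assumes "bounded_comm P"
  shows "bounded_comm (simulate L U R adv inp P)"
proof -
  obtain B where B: "\<And>x r. halted P x r B"
    "\<And>x r i q a. (i, q, a) \<in> set (run P x r B) \<Longrightarrow> length q \<le> B \<and> length a \<le> B"
    using assms unfolding bounded_comm_def by fast
  \<comment> \<open>One number bounds rounds and lengths: queries grow by \<open>L\<close>, and the
    run of \<open>P\<close> is stationary from round \<open>B\<close> on.\<close>
  have "halted (simulate L U R adv inp P) y r (B + L) \<and>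
     (\<forall>(i, q, a) \<in> set (run (simulate L U R adv inp P) y r (B + L)). length q \<le> B + L \<and> length a \<le> B + L)"
    for y r
  proof -
    obtain r' u b where r: "sim_coins r = (r', u :: 'u, b :: 'k \<Rightarrow> 'b)"
      using prod_cases3 by blast
    let ?x = "\<lambda>i. inp i (b i) (adv u i) (y i)"
    have st: "run P ?x r' (B + L) = run P ?x r' B"
      by (rule run_stable[OF B(1)]) simp
    have h: "halted P ?x r' (B + L)"
      using B(1)[of ?x r'] by (simp add: halted_def st)
    show ?thesis
      by (auto simp: run_simulate[OF len r] h st len dest!: B(2))
  qed
  then show ?thesis
    unfolding bounded_comm_def by blast
qed

end

lemma measure_bind_pmf_le:
  assumes "\<And>x. measure_pmf.prob (q x) A \<le> c"
  shows "measure_pmf.prob (bind_pmf p q) A \<le> c"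
proof -
  have c: "0 \<le> c"
    using assms measure_nonneg order_trans by blast
  have "ennreal (measure_pmf.prob (bind_pmf p q) A) = (\<integral>\<^sup>+x. emeasure (measure_pmf (q x)) A \<partial>measure_pmf p)"
    by (simp flip: measure_pmf.emeasure_eq_measure)
  also have "\<dots> \<le> (\<integral>\<^sup>+x. ennreal c \<partial>measure_pmf p)"
    using assms by (intro nn_integral_mono) (simp add: measure_pmf.emeasure_eq_measure ennreal_leI)
  finally show ?thesis
    using c by simp
qed

text \<open>For fixed draws \<open>u\<close> and \<open>b\<close> the simulation errs exactly when
  \<open>P\<close> errs on one assembled input, and the error of \<open>P\<close> is bounded on
  every input. Averaging keeps the bound because assumption \<open>g\<close> makes the reduction
  correct for all draws.\<close>

lemma error_protocol_simulate:
  fixes P :: "('k::finite, 'a) protocol" and U :: "'u::countable pmf" and R :: "'b::countable pmf"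
  assumes len: "\<And>u i. length (adv u i) = L"
    and P: "error_protocol \<delta> f P"
    and g: "\<And>y u b. f (\<lambda>i. inp i (b i) (adv u i) (y i)) = g y"
  shows "error_protocol \<delta> g (simulate L U R adv inp P)"
  unfolding error_protocol_def
proof (intro conjI allI)
  let ?S = "simulate L U R adv inp P"
  show "bounded_comm ?S"
    using P by (intro bounded_comm_simulate[OF len]) (simp add: error_protocol_def)
  fix y
  let ?x = "\<lambda>u b i. inp i (b i) (adv u i) (y i)"
  let ?bad = "{(r, u, b). outcome P (?x u b) r \<noteq> f (?x u b)}"
  have "{r. outcome ?S y r \<noteq> g y} = sim_coins -` ?bad"
  proof (rule set_eqI)
    fix r
    obtain r' u b where r: "sim_coins r = (r', u :: 'u, b :: 'k \<Rightarrow> 'b)"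
      using prod_cases3 by blast
    show "r \<in> {r. outcome ?S y r \<noteq> g y} \<longleftrightarrow> r \<in> sim_coins -` ?bad"
      by (simp add: r outcome_simulate[OF len r] g)
  qed
  then have "measure_pmf.prob (coins ?S) {r. outcome ?S y r \<noteq> g y} =
      measure_pmf.prob (pair_pmf (coins P) (pair_pmf U (Pi_pmf UNIV undefined (\<lambda>_. R)))) ?bad"
    by (simp flip: map_pmf_sim_coins[of L U R adv inp P])
  \<comment> \<open>The advice and the private draws are taken first, so that the coins of
    \<open>P\<close> meet a fixed input.\<close>
  also have "pair_pmf (coins P) (pair_pmf U (Pi_pmf UNIV undefined (\<lambda>_. R))) =
      bind_pmf (pair_pmf U (Pi_pmf UNIV undefined (\<lambda>_. R))) (\<lambda>ub. map_pmf (\<lambda>r. (r, ub)) (coins P))"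
    by (subst pair_commute_pmf) (simp add: pair_pmf_def map_pmf_def bind_assoc_pmf bind_return_pmf)
  also have "measure_pmf.prob \<dots> ?bad \<le> \<delta>"
    using P by (intro measure_bind_pmf_le) (auto simp: error_protocol_def vimage_def split: prod.split)
  finally show "measure_pmf.prob (coins ?S) {r. outcome ?S y r \<noteq> g y} \<le> \<delta>" .
qed

section \<open>Advice words, and existence of a protocol for every function\<close>

text \<open>The enumeration of the index type is arbitrary but fixed: distinct functions get
  distinct words, all of the same length, as the advice requires.\<close>

definition encode :: "('c::finite \<Rightarrow> bool) \<Rightarrow> msg" where
  "encode f = map f (SOME cs. set cs = UNIV \<and> distinct cs)"

lemma enum_UNIV:
  "set (SOME cs. set cs = (UNIV :: 'c::finite set) \<and> distinct cs) = UNIV"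
  "distinct (SOME cs. set cs = (UNIV :: 'c::finite set) \<and> distinct cs)"
  using someI_ex[OF finite_distinct_list[OF finite[of "UNIV :: 'c set"]]] by auto

lemma length_encode: "length (encode (f :: 'c::finite \<Rightarrow> bool)) = CARD('c)"
  using distinct_card[OF enum_UNIV(2)[where 'c = 'c]] by (simp add: encode_def enum_UNIV)

lemma inj_encode: "inj encode"
  by (rule injI) (auto simp: encode_def enum_UNIV map_eq_conv)

lemma inv_encode: "inv encode (encode f) = f"
  by (simp add: inj_encode)

text \<open>The set over which the information complexity takes its infimum is thereby
  nonempty.\<close>

lemma ex_error_protocol:
  fixes f :: "('k::finite \<Rightarrow> 'c::finite \<Rightarrow> bool) \<Rightarrow> bool"
  assumes "0 \<le> \<delta>"
  shows "\<exists>P. error_protocol \<delta> f P"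
proof -
  obtain ks :: "'k list" where ks: "set ks = UNIV" "distinct ks"
    using finite_distinct_list[OF finite] by blast
  \<comment> \<open>Each processor sends its whole input once; the length of the transcript tells
    whom to ask next, and \<open>map_of\<close> looks up the replies.\<close>
  define P :: "('k, 'c \<Rightarrow> bool) protocol" where "P = \<lparr>coord_coins = return_pmf 0,
     proc_coins = (\<lambda>_. return_pmf 0),
     coord = (\<lambda>_ tr. if length tr < length ks then Query (ks ! length tr) []
       else Halt (f (\<lambda>i. inv encode (snd (the (map_of tr i)))))),
     proc = (\<lambda>i _ x _ _. encode x)\<rparr>"
  have run: "run P x r n = map (\<lambda>i. (i, [], encode (x i))) (take n ks)" for x r n
  proof (induction n)
    case (Suc n)
    show ?case
    proof (cases "n < length ks")
      case True
      then show ?thesis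
        unfolding run.simps Suc by (simp add: Let_def P_def min_def take_Suc_conv_app_nth)
    next
      case False
      then show ?thesis
        unfolding run.simps Suc by (simp add: Let_def P_def)
    qed
  qed simp
  let ?n = "length ks"
  have coord: "coord P c (run P x r ?n) = Halt (f x)" for c x r
  proof -
    have "map_of (map (\<lambda>i. (i, [], encode (x i))) ks) i = Some ([] :: msg, encode (x i))" for i
      using ks by (simp add: map_of_map_restrict)
    then show ?thesis
      unfolding run by (simp add: P_def inv_encode)
  qed
  have "bounded_comm P"
  proof -
    let ?B = "?n + CARD('c)"
    have "halted P x r ?n" for x r
      by (simp add: halted_def coord)
    then have st: "run P x r ?B = run P x r ?n" for x r
      by (rule run_stable) simp
    then have "halted P x r ?B" for x r
      by (simp add: halted_def coord)
    moreover have "length q \<le> ?B \<and> length a \<le> ?B" if "(i, q, a) \<in> set (run P x r ?B)" for x r i q a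
      using that unfolding st run by (auto simp: length_encode)
    ultimately show ?thesis
      unfolding bounded_comm_def by blast
  qed
  moreover have "outcome P x r = f x" for x r
    using halted_Least(2)[of P x r ?n] by (simp add: outcome_def coord halted_def)
  ultimately show ?thesis
    using assms unfolding error_protocol_def by (intro exI[of _ P]) simp
qed

section \<open>Embedding one block\<close>

abbreviation uniform :: "'a::finite pmf" where
  "uniform \<equiv> pmf_of_set UNIV"

section \<open>Splicing independent samples of a product distribution\<close>

lemma Pi_pmf_uniform: "Pi_pmf UNIV d (\<lambda>_::'i::finite. uniform :: 'a::finite pmf) = uniform"
  by (subst Pi_pmf_of_set) (auto simp: PiE_dflt_def)

lemma map_pmf_uniform_flip:
  "map_pmf (\<lambda>f x y. f y x) (uniform :: ('a::finite \<Rightarrow> 'b::finite \<Rightarrow> 'c::finite) pmf) = uniform"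
  by (rule map_pmf_of_set_bij_betw[of _ UNIV])
     (auto intro!: bij_betw_byWitness[where f' = "\<lambda>f x y. f y x"])

text \<open>At each coordinate one of two independent draws is kept and the other discarded, which
  leaves \<open>p x\<close>.\<close>

lemma Pi_pmf_splice:
  fixes p :: "'i::finite \<Rightarrow> 'a pmf"
  shows "Pi_pmf UNIV d p = do {f \<leftarrow> Pi_pmf UNIV d1 p; g \<leftarrow> Pi_pmf UNIV d2 p; return_pmf (\<lambda>x. if x \<in> A then f x else g x)}"
proof -
  have "Pi_pmf UNIV d p = Pi_pmf UNIV d (\<lambda>x. do {a \<leftarrow> p x; b \<leftarrow> p x; return_pmf (if x \<in> A then a else b)})"
  proof (intro Pi_pmf_cong refl)
    fix x
    show "p x = do {a \<leftarrow> p x; b \<leftarrow> p x; return_pmf (if x \<in> A then a else b)}"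
      by (cases "x \<in> A") (simp_all add: bind_return_pmf')
  qed
  also have "\<dots> = do {f \<leftarrow> Pi_pmf UNIV d1 p; g \<leftarrow> Pi_pmf UNIV d2 p; return_pmf (\<lambda>x. if x \<in> A then f x else g x)}"
    by (subst Pi_pmf_bind[where d' = d1], simp, subst Pi_pmf_bind[where d' = d2], simp_all)
  finally show ?thesis .
qed

lemma Pi_pmf_resample:
  fixes p :: "'i::finite \<Rightarrow> 'a pmf"
  shows "Pi_pmf UNIV d p = do {f \<leftarrow> Pi_pmf UNIV d p; y \<leftarrow> p t; return_pmf (f(t := y))}"
proof -
  have "Pi_pmf UNIV d p = do {f \<leftarrow> Pi_pmf UNIV d p; g \<leftarrow> Pi_pmf UNIV d p; return_pmf (\<lambda>x. if x \<in> -{t} then f x else g x)}"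
    by (rule Pi_pmf_splice)
  also have "\<dots> = do {f \<leftarrow> Pi_pmf UNIV d p; y \<leftarrow> map_pmf (\<lambda>g. g t) (Pi_pmf UNIV d p); return_pmf (f(t := y))}"
    unfolding bind_map_pmf
    by (intro bind_pmf_cong refl arg_cong[of _ _ return_pmf]) auto
  also have "map_pmf (\<lambda>g. g t) (Pi_pmf UNIV d p) = p t"
    by (simp add: Pi_pmf_component)
  finally show ?thesis .
qed

text \<open>Three sources, as in the embedding: \<open>A\<close> will be the earlier blocks,
  \<open>t\<close> the block of the \<open>Disj\<close> input, and the rest the later
  blocks.\<close>

lemma Pi_pmf_splice3:
  fixes p :: "'i::finite \<Rightarrow> 'a pmf"
  shows "Pi_pmf UNIV d p = do {f \<leftarrow> Pi_pmf UNIV d p; y \<leftarrow> p t; g \<leftarrow> Pi_pmf UNIV d p;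
    return_pmf (\<lambda>x. if x \<in> A then f x else if x = t then y else g x)}"
  (is "_ = ?rhs")
proof -
  have "Pi_pmf UNIV d p = do {f \<leftarrow> Pi_pmf UNIV d p; g \<leftarrow> Pi_pmf UNIV d p; return_pmf (\<lambda>x. if x \<in> A then f x else g x)}"
    by (rule Pi_pmf_splice)
  also have "\<dots> = do {f \<leftarrow> Pi_pmf UNIV d p; g \<leftarrow> do {g \<leftarrow> Pi_pmf UNIV d p; y \<leftarrow> p t; return_pmf (g(t := y))};
      return_pmf (\<lambda>x. if x \<in> A then f x else g x)}"
    by (simp only: Pi_pmf_resample[symmetric])
  also have "\<dots> = do {f \<leftarrow> Pi_pmf UNIV d p; y \<leftarrow> p t; g \<leftarrow> Pi_pmf UNIV d p;
      return_pmf (\<lambda>x. if x \<in> A then f x else (g(t := y)) x)}"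
    by (subst bind_commute_pmf[of "p t"]) (simp add: bind_assoc_pmf bind_return_pmf)
  also have "\<dots> = ?rhs"
    by (simp add: fun_upd_def cong: if_cong)
  finally show ?thesis .
qed

lemma uniform_resample:
  "(uniform :: ('i::finite \<Rightarrow> 'a::finite) pmf) = do {f \<leftarrow> uniform; y \<leftarrow> uniform; return_pmf (f(t := y))}"
  using Pi_pmf_resample[of undefined "\<lambda>_. uniform"] by (simp only: Pi_pmf_uniform)

text \<open>The three-way splice is applied to each row \<open>k\<close> separately, since each
  processor has its own bits.\<close>

lemma uniform_splice3:
  "(uniform :: ('k::finite \<Rightarrow> 'i::finite \<Rightarrow> 'a::finite) pmf) = do {f \<leftarrow> uniform; y \<leftarrow> uniform; g \<leftarrow> uniform;
    return_pmf (\<lambda>k x. if x \<in> A then f k x else if x = t then y k else g k x)}"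
proof -
  have *: "(uniform :: ('i \<Rightarrow> 'a) pmf) = do {f \<leftarrow> uniform; y \<leftarrow> uniform; g \<leftarrow> uniform;
    return_pmf (\<lambda>x. if x \<in> A then f x else if x = t then y else g x)}"
    using Pi_pmf_splice3[of undefined "\<lambda>_. uniform :: 'a pmf" t A] by (simp only: Pi_pmf_uniform)
  have "(uniform :: ('k \<Rightarrow> 'i \<Rightarrow> 'a) pmf) = Pi_pmf UNIV undefined (\<lambda>_. do {f \<leftarrow> uniform; y \<leftarrow> uniform; g \<leftarrow> uniform;
    return_pmf (\<lambda>x. if x \<in> A then f x else if x = t then y else g x)})"
    by (simp only: *[symmetric] Pi_pmf_uniform)
  also have "\<dots> = do {f \<leftarrow> uniform; y \<leftarrow> uniform; g \<leftarrow> uniform;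
    return_pmf (\<lambda>k x. if x \<in> A then f k x else if x = t then y k else g k x)}"
    by (subst Pi_pmf_bind[where d' = undefined], simp, subst Pi_pmf_bind[where d' = undefined], simp,
        subst Pi_pmf_bind[where d' = undefined], simp, simp add: Pi_pmf_uniform)
  finally show ?thesis .
qed

section \<open>The hard distributions generated from independent uniform bits\<close>

text \<open>
  Drawing the bits \<open>b\<close> uniformly and independently exhibits the rows as independent given the
  auxiliary variables.
\<close>

definition block_row :: "'k \<Rightarrow> ('l \<Rightarrow> bool) \<Rightarrow> ('l \<Rightarrow> 'k) \<Rightarrow> 'l \<Rightarrow> ('l \<Rightarrow> bool) \<Rightarrow> 'l \<Rightarrow> bool" where
  "block_row i m z w b j \<longleftrightarrow> j = w \<or> i \<noteq> z j \<and> (m j \<or> b j)"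

definition mode_dist :: "('l::finite \<Rightarrow> bool) pmf" where
  "mode_dist = Pi_pmf UNIV undefined (\<lambda>_. bernoulli_pmf (1/3))"

text \<open>Every processor tosses a fair bit, which is ignored where \<open>m\<close> or
  \<open>z\<close> forces the entry; this replaces the case distinction by one uniform draw.\<close>

lemma column_dist_eq:
  "(column_dist :: (('k::finite \<Rightarrow> bool) \<times> bool \<times> 'k) pmf) = do {m \<leftarrow> bernoulli_pmf (1/3); z \<leftarrow> uniform; b \<leftarrow> uniform;
    return_pmf (\<lambda>i. i \<noteq> z \<and> (m \<or> b i), m, z)}"
proof -
  have "Pi_pmf UNIV False (\<lambda>i. if i = z then return_pmf False
          else if m then return_pmf True else bernoulli_pmf (1/2)) =
      map_pmf (\<lambda>b i. i \<noteq> z \<and> (m \<or> b i)) uniform" for z :: 'k and m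
  proof -
    have or: "(\<or>) True = (\<lambda>_. True)" "(\<or>) False = (\<lambda>b. b)"
      by auto
    have "Pi_pmf UNIV False (\<lambda>i. if i = z then return_pmf False
            else if m then return_pmf True else bernoulli_pmf (1/2)) =
        Pi_pmf UNIV False (\<lambda>i. map_pmf (\<lambda>b. i \<noteq> z \<and> (m \<or> b)) uniform)"
      by (intro Pi_pmf_cong) (auto simp: bernoulli_pmf_half_conv_pmf_of_set or)
    also have "\<dots> = map_pmf (\<lambda>b i. i \<noteq> z \<and> (m \<or> b i)) (Pi_pmf UNIV undefined (\<lambda>_. uniform))"
      by (rule map_pmf_Pi_pmf_UNIV[symmetric])
    finally show ?thesis
      by (simp only: Pi_pmf_uniform)
  qed
  then show ?thesis
    by (simp add: column_dist_def bind_map_pmf)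
qed

lemma zeta_eq:
  "(zeta :: (('k::finite \<Rightarrow> 'l::finite \<Rightarrow> bool) \<times> ('l \<Rightarrow> bool) \<times> ('l \<Rightarrow> 'k) \<times> 'l) pmf) =
    do {m \<leftarrow> mode_dist; z \<leftarrow> uniform; w \<leftarrow> uniform; b \<leftarrow> uniform;
      return_pmf (\<lambda>i. block_row i m z w (b i), m, z, w)}"
proof -
  have cols: "Pi_pmf UNIV undefined (\<lambda>_::'l. column_dist :: (('k \<Rightarrow> bool) \<times> bool \<times> 'k) pmf) =
      do {m \<leftarrow> mode_dist; z \<leftarrow> uniform; b \<leftarrow> uniform; return_pmf (\<lambda>j. (\<lambda>i. i \<noteq> z j \<and> (m j \<or> b j i), m j, z j))}"
    unfolding column_dist_eq mode_dist_def
    by (subst Pi_pmf_bind[where d' = undefined], simp, subst Pi_pmf_bind[where d' = undefined], simp,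
        subst Pi_pmf_bind[where d' = undefined], simp, simp add: Pi_pmf_uniform)
  have "(zeta :: (('k \<Rightarrow> 'l \<Rightarrow> bool) \<times> ('l \<Rightarrow> bool) \<times> ('l \<Rightarrow> 'k) \<times> 'l) pmf) = do {m \<leftarrow> mode_dist; z \<leftarrow> uniform; b \<leftarrow> uniform; w \<leftarrow> uniform;
      return_pmf (\<lambda>i. block_row i m z w (\<lambda>j. b j i), m, z, w)}"
    unfolding zeta_def cols
    unfolding bind_assoc_pmf bind_return_pmf
    by (intro bind_pmf_cong refl arg_cong[of _ _ return_pmf]) (auto simp: block_row_def fun_eq_iff)
  \<comment> \<open>The bits arise column by column; transposing a uniform matrix leaves it uniform
    and gives one row of bits per processor.\<close>
  also have "\<dots> = do {m \<leftarrow> mode_dist; z \<leftarrow> uniform; b \<leftarrow> map_pmf (\<lambda>f x y. f y x) uniform; w \<leftarrow> uniform;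
      return_pmf (\<lambda>i. block_row i m z w (b i), m, z, w)}"
    by (simp only: bind_map_pmf)
  also have "\<dots> = do {m \<leftarrow> mode_dist; z \<leftarrow> uniform; w \<leftarrow> uniform; b \<leftarrow> uniform;
      return_pmf (\<lambda>i. block_row i m z w (b i), m, z, w)}"
    by (simp only: map_pmf_uniform_flip bind_commute_pmf[of "uniform :: ('k \<Rightarrow> 'l \<Rightarrow> bool) pmf"])
  finally show ?thesis .
qed

type_synonym ('k, 'm, 'l) aux = "('m \<Rightarrow> 'l \<Rightarrow> bool) \<times> ('m \<Rightarrow> 'l \<Rightarrow> 'k) \<times> ('m \<Rightarrow> 'l)"

lemma zeta_power_eq:
  "(zeta_power :: (('k::finite \<Rightarrow> 'm::finite \<times> 'l::finite \<Rightarrow> bool) \<times>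
      ('m \<Rightarrow> 'l \<Rightarrow> bool) \<times> ('m \<Rightarrow> 'l \<Rightarrow> 'k) \<times> ('m \<Rightarrow> 'l)) pmf) =
    do {m \<leftarrow> Pi_pmf UNIV undefined (\<lambda>_. mode_dist); z \<leftarrow> uniform; w \<leftarrow> uniform; b \<leftarrow> uniform;
      return_pmf (\<lambda>i (t, j). block_row i (m t) (z t) (w t) (b i t) j, m, z, w)}"
proof -
  have blocks: "Pi_pmf UNIV undefined (\<lambda>_::'m. zeta :: (('k \<Rightarrow> 'l \<Rightarrow> bool) \<times> ('l \<Rightarrow> bool) \<times> ('l \<Rightarrow> 'k) \<times> 'l) pmf) =
      do {m \<leftarrow> Pi_pmf UNIV undefined (\<lambda>_. mode_dist); z \<leftarrow> uniform; w \<leftarrow> uniform; b \<leftarrow> uniform;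
        return_pmf (\<lambda>t. (\<lambda>i. block_row i (m t) (z t) (w t) (b t i), m t, z t, w t))}"
    unfolding zeta_eq
    by (subst Pi_pmf_bind[where d' = undefined], simp, subst Pi_pmf_bind[where d' = undefined], simp,
        subst Pi_pmf_bind[where d' = undefined], simp, subst Pi_pmf_bind[where d' = undefined], simp,
        simp add: Pi_pmf_uniform)
  have "(zeta_power :: (('k \<Rightarrow> 'm \<times> 'l \<Rightarrow> bool) \<times> ('k, 'm, 'l) aux) pmf) = do {m \<leftarrow> Pi_pmf UNIV undefined (\<lambda>_. mode_dist); z \<leftarrow> uniform; w \<leftarrow> uniform;
      b \<leftarrow> map_pmf (\<lambda>f x y. f y x) uniform;
      return_pmf (\<lambda>i (t, j). block_row i (m t) (z t) (w t) (b i t) j, m, z, w)}"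
    unfolding zeta_power_def blocks
    by (simp add: bind_assoc_pmf bind_return_pmf bind_map_pmf)
  then show ?thesis
    by (simp only: map_pmf_uniform_flip)
qed

section \<open>The embedded protocol for one block\<close>

text \<open>
  The injective \<open>h\<close> gives the order of the blocks. The rows after \<open>t\<close> come from the coordinator, so
  that the processors do not learn \<open>M\<close> there.
\<close>

definition later :: "('m \<Rightarrow> nat) \<Rightarrow> 'm \<Rightarrow> ('m \<times> 'l \<Rightarrow> bool) \<Rightarrow> 'm \<times> 'l \<Rightarrow> bool" where
  "later h t x = (\<lambda>(t', j). h t < h t' \<and> x (t', j))"

text \<open>Of the coordinator's draw, processor \<open>i\<close> receives only its own rows. The
  modes after \<open>t\<close> are the fresh \<open>m\<close>, whereas \<open>Z\<close> and
  \<open>W\<close> are hard-wired.\<close>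

definition advice :: "('m::finite \<Rightarrow> nat) \<Rightarrow> 'm \<Rightarrow> ('k, 'm, 'l::finite) aux \<Rightarrow>
    ('m \<Rightarrow> 'l \<Rightarrow> bool) \<times> ('k \<Rightarrow> 'm \<Rightarrow> 'l \<Rightarrow> bool) \<Rightarrow> 'k \<Rightarrow> msg" where
  "advice h t = (\<lambda>(M, Z, W) (m, b) i. encode (later h t (\<lambda>(t', j). block_row i (m t') (Z t') (W t') (b i t') j)))"

text \<open>The earlier blocks can be drawn privately because the rows are independent across
  processors once \<open>M\<close>, \<open>Z\<close>, \<open>W\<close> are fixed.\<close>

definition assemble :: "('m::finite \<Rightarrow> nat) \<Rightarrow> 'm \<Rightarrow> ('k, 'm, 'l::finite) aux \<Rightarrow>
    'k \<Rightarrow> ('m \<Rightarrow> 'l \<Rightarrow> bool) \<Rightarrow> msg \<Rightarrow> ('l \<Rightarrow> bool) \<Rightarrow> 'm \<times> 'l \<Rightarrow> bool" where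
  "assemble h t = (\<lambda>(M, Z, W) i b q y (t', j).
     if h t' < h t then block_row i (M t') (Z t') (W t') (b t') j
     else if t' = t then y j
     else inv encode q (t', j))"

definition embed :: "('m::finite \<Rightarrow> nat) \<Rightarrow> 'm \<Rightarrow> ('k::finite, 'm, 'l::finite) aux \<Rightarrow>
    ('k, 'm \<times> 'l \<Rightarrow> bool) protocol \<Rightarrow> ('k, 'l \<Rightarrow> bool) protocol" where
  "embed h t d P = simulate CARD('m \<times> 'l) (pair_pmf (Pi_pmf UNIV undefined (\<lambda>_. mode_dist)) uniform) uniform
     (advice h t d) (assemble h t d) P"

lemma length_advice:
  fixes d :: "('k, 'm::finite, 'l::finite) aux"
  shows "length (advice h t d u i) = CARD('m \<times> 'l)"
  by (auto simp: advice_def length_encode split: prod.split)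

text \<open>In every block other than \<open>t\<close> the column given by \<open>W\<close> is all
  ones whatever is drawn, so \<open>Tribes\<close> collapses with certainty to the
  \<open>Disj\<close> value of block \<open>t\<close>. Injectivity of \<open>h\<close> puts each
  such block strictly before or after \<open>t\<close>.\<close>

lemma error_protocol_embed:
  fixes P :: "('k::finite, 'm::finite \<times> 'l::finite \<Rightarrow> bool) protocol"
  assumes h: "inj h" and P: "error_protocol \<delta> Tribes P"
  shows "error_protocol \<delta> Disj (embed h t d P)"
  unfolding embed_def
proof (rule error_protocol_simulate[OF length_advice P])
  fix y :: "'k \<Rightarrow> 'l \<Rightarrow> bool" and u :: "('m \<Rightarrow> 'l \<Rightarrow> bool) \<times> ('k \<Rightarrow> 'm \<Rightarrow> 'l \<Rightarrow> bool)" and b :: "'k \<Rightarrow> 'm \<Rightarrow> 'l \<Rightarrow> bool"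
  obtain M Z W where d: "d = (M, Z, W)" using prod_cases3 by blast
  let ?x = "\<lambda>i. assemble h t d i (b i) (advice h t d u i) (y i)"
  have "?x i (t', W t')" if "t' \<noteq> t" for i t'
  proof -
    have "h t' \<noteq> h t"
      using that injD[OF h] by blast
    then show ?thesis
      using that by (cases u) (simp add: assemble_def advice_def d later_def block_row_def inv_encode)
  qed
  then have "Disj (\<lambda>i j. ?x i (t', j))" if "t' \<noteq> t" for t'
    unfolding Disj_def using that by blast
  moreover have y: "(\<lambda>i j. ?x i (t, j)) = y"
    by (simp add: assemble_def d)
  ultimately have "Disj (\<lambda>i j. ?x i (t', j))" if "Disj y" for t'
    using that by (cases "t' = t") simp_all
  moreover have "Disj y" if "Tribes ?x"
    using that[unfolded Tribes_def, rule_format, of t] unfolding y .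
  ultimately show "Tribes ?x = Disj y"
    unfolding Tribes_def by blast
qed

text \<open>Entries that are not hard-wired are erased by \<open>undefined\<close>, so conditioning
  on the tuple reveals exactly \<open>M\<close> before \<open>t\<close> and \<open>Z\<close>,
  \<open>W\<close> away from \<open>t\<close>.\<close>

definition hardwired :: "('m \<Rightarrow> nat) \<Rightarrow> 'm \<Rightarrow> ('k, 'm, 'l) aux \<Rightarrow> ('k, 'm, 'l) aux" where
  "hardwired h t = (\<lambda>(M, Z, W). (\<lambda>t'. if h t' < h t then M t' else undefined, Z(t := undefined), W(t := undefined)))"

definition hardwired_dist :: "('m::finite \<Rightarrow> nat) \<Rightarrow> 'm \<Rightarrow> ('k::finite, 'm, 'l::finite) aux pmf" where
  "hardwired_dist h t = do {M \<leftarrow> Pi_pmf UNIV undefined (\<lambda>_. mode_dist); Z \<leftarrow> uniform; W \<leftarrow> uniform;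
     return_pmf (hardwired h t (M, Z, W))}"

definition prefix_queries :: "('c::finite \<Rightarrow> bool) \<Rightarrow> view \<Rightarrow> view" where
  "prefix_queries u v = map (\<lambda>(q, a). (encode u @ q, a)) v"

text \<open>Brings draws that feed the same variable together. The distributions are abstract
  because some of the concrete draws share one distribution, so that a rule exchanging them could
  not tell them apart.\<close>

lemma bind_pmf_reorder:
  fixes pM :: "'a1 pmf" and pZ :: "'a2 pmf" and pW :: "'a3 pmf" and pm :: "'a4 pmf" and pz :: "'a5 pmf"
    and pw :: "'a6 pmf" and pb :: "'a7 pmf" and pr :: "'a8 pmf" and pm1 :: "'a9 pmf" and pb1 :: "'b1 pmf"
    and pb2 :: "'b2 pmf"
  shows
  "do {M \<leftarrow> pM; Z \<leftarrow> pZ; W \<leftarrow> pW; m \<leftarrow> pm; z \<leftarrow> pz; w \<leftarrow> pw; b \<leftarrow> pb; r \<leftarrow> pr; m1 \<leftarrow> pm1; b1 \<leftarrow> pb1; b2 \<leftarrow> pb2;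
      return_pmf (f M Z W m z w b r m1 b1 b2)} =
   do {M \<leftarrow> pM; m \<leftarrow> pm; m1 \<leftarrow> pm1; Z \<leftarrow> pZ; z \<leftarrow> pz; W \<leftarrow> pW; w \<leftarrow> pw; b2 \<leftarrow> pb2; b \<leftarrow> pb; b1 \<leftarrow> pb1; r \<leftarrow> pr;
      return_pmf (f M Z W m z w b r m1 b1 b2)}"
  by (simp only: bind_commute_pmf[of pZ pm] bind_commute_pmf[of pW pm] bind_commute_pmf[of pZ pm1] bind_commute_pmf[of pW pm1] bind_commute_pmf[of pz pm1] bind_commute_pmf[of pw pm1] bind_commute_pmf[of pb pm1] bind_commute_pmf[of pr pm1] bind_commute_pmf[of pW pz] bind_commute_pmf[of pb pb2] bind_commute_pmf[of pr pb2] bind_commute_pmf[of pb1 pb2] bind_commute_pmf[of pr pb1])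

text \<open>The draws from all sources splice into one sample of \<open>zeta_power\<close>, so
  inside the embedding \<open>P\<close> meets its own hard distribution. The advice remains visible
  as a prefix of every query.\<close>

lemma bind_zeta_embed:
  fixes P :: "('k::finite, 'm::finite \<times> 'l::finite \<Rightarrow> bool) protocol"
  assumes h: "inj h"
  shows "bind_pmf (hardwired_dist h t) (\<lambda>d. map_pmf (\<lambda>((x, m, z, w), r).
        (d, x i, m, z, w, view i (transcript (embed h t d P) x r))) (pair_pmf zeta (coins (embed h t d P)))) =
    map_pmf (\<lambda>((x, m, z, w), r). (hardwired h t (m, z, w), \<lambda>j. x i (t, j), m t, z t, w t,
        prefix_queries (later h t (x i)) (view i (transcript P x r)))) (pair_pmf zeta_power (coins P))"
proof -
  let ?md = "Pi_pmf UNIV undefined (\<lambda>_. mode_dist) :: ('m \<Rightarrow> 'l \<Rightarrow> bool) pmf"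
  define A where "A = {t'. h t' < h t}"
  define obs where "obs = (\<lambda>m z w (b :: 'k \<Rightarrow> 'm \<Rightarrow> 'l \<Rightarrow> bool) r.
    (let x = (\<lambda>i (t, j). block_row i (m t) (z t) (w t) (b i t) j) in
      (hardwired h t (m, z, w), \<lambda>j. x i (t, j), m t, z t, w t :: 'l,
        prefix_queries (later h t (x i)) (view i (transcript P x r)))))"
  \<comment> \<open>Blocks before \<open>t\<close> come from the hard-wired \<open>M\<close> and the
    processors' bits \<open>b2\<close>, block \<open>t\<close> from the \<open>Disj\<close> input,
    and the later blocks from the coordinator's draws.\<close>
  define sM where "sM = (\<lambda>M (m :: 'l \<Rightarrow> bool) m' t'. if t' \<in> A then M t' else if t' = t then m else m' t')"
  define sB where "sB = (\<lambda>(b2 :: 'k \<Rightarrow> 'm \<Rightarrow> 'l \<Rightarrow> bool) b b1 i t'. if t' \<in> A then b2 i t' else if t' = t then b i else b1 i t')"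
  \<comment> \<open>A pointwise identity: for fixed draws the embedded protocol runs
    \<open>P\<close> on the rows built from the spliced values.\<close>
  have key: "(let d = hardwired h t (M, Z, W); x = (\<lambda>i. assemble h t d i (b2 i) (advice h t d (m1, b1) i) (block_row i m z w (b i))) in
       (d, block_row i m z w (b i), m, z, w, map (\<lambda>(q, a). (advice h t d (m1, b1) i @ q, a)) (view i (transcript P x r)))) =
     obs (sM M m m1) (Z(t := z)) (W(t := w)) (sB b2 b b1) r" for M Z W m z w b r m1 b1 b2
  proof -
    let ?d = "hardwired h t (M, Z, W)"
    let ?x = "\<lambda>i (t', j). block_row i (sM M m m1 t') ((Z(t := z)) t') ((W(t := w)) t') (sB b2 b b1 i t') j"
    have t': "t' = t \<or> h t' < h t \<or> h t < h t'" for t'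
      using linorder_neqE_nat[of "h t'" "h t"] injD[OF h, of t' t] by blast
    have d: "hardwired h t (sM M m m1, Z(t := z), W(t := w)) = ?d"
      by (auto simp: hardwired_def sM_def A_def fun_eq_iff)
    have adv: "advice h t ?d (m1, b1) i = encode (later h t (?x i))" for i
      by (auto simp: advice_def hardwired_def later_def sM_def sB_def A_def fun_eq_iff intro!: arg_cong[of _ _ encode])
    have x: "assemble h t ?d i (b2 i) (advice h t ?d (m1, b1) i) (block_row i m z w (b i)) = ?x i" for i
    proof (rule ext)
      fix c :: "'m \<times> 'l"
      show "assemble h t ?d i (b2 i) (advice h t ?d (m1, b1) i) (block_row i m z w (b i)) c = ?x i c"
        unfolding adv using t'[of "fst c"]
        by (cases c) (auto simp: assemble_def hardwired_def inv_encode later_def sM_def sB_def A_def)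
    qed
    show ?thesis
      unfolding obs_def Let_def x unfolding d adv by (simp add: prefix_queries_def sM_def sB_def A_def)
  qed
  define F where "F = (\<lambda>d m z w b (r, u, b2). 
    let x = (\<lambda>i. assemble h t d i (b2 i) (advice h t d u i) (block_row i m z w (b i))) in
       (d, block_row i m z w (b i), m, z, w, map (\<lambda>(q, a). (advice h t d u i @ q, a)) (view i (transcript P x r))))"
  have F: "map_pmf (\<lambda>r. (d, block_row i m z w (b i), m, z, w, view i (transcript (embed h t d P) (\<lambda>i. block_row i m z w (b i)) r)))
      (coins (embed h t d P)) = map_pmf (F d m z w b) (pair_pmf (coins P) (pair_pmf (pair_pmf ?md uniform) uniform))"
    for d m z w b
  proof -
    have "(d, block_row i m z w (b i), m, z, w, view i (transcript (embed h t d P) (\<lambda>i. block_row i m z w (b i)) r)) =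
       F d m z w b (sim_coins r)" for r
    proof -
      obtain r' u b2 where r: "sim_coins r = (r', u :: ('m \<Rightarrow> 'l \<Rightarrow> bool) \<times> ('k \<Rightarrow> 'm \<Rightarrow> 'l \<Rightarrow> bool), b2 :: 'k \<Rightarrow> 'm \<Rightarrow> 'l \<Rightarrow> bool)"
        using prod_cases3 by blast
      show ?thesis
        unfolding embed_def view_simulate[OF length_advice r] by (simp add: F_def r Let_def)
    qed
    then have "map_pmf (\<lambda>r. (d, block_row i m z w (b i), m, z, w, view i (transcript (embed h t d P) (\<lambda>i. block_row i m z w (b i)) r)))
      (coins (embed h t d P)) = map_pmf (F d m z w b) (map_pmf sim_coins (coins (embed h t d P)))"
      by (simp add: pmf.map_comp o_def)
    then show ?thesis
      unfolding embed_def map_pmf_sim_coins[where d = undefined] Pi_pmf_uniform .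
  qed
  have "bind_pmf (hardwired_dist h t) (\<lambda>d. map_pmf (\<lambda>((x, m, z, w), r).
        (d, x i, m, z, w, view i (transcript (embed h t d P) x r))) (pair_pmf zeta (coins (embed h t d P)))) =
     do {M \<leftarrow> ?md; Z \<leftarrow> uniform; W \<leftarrow> uniform; m \<leftarrow> mode_dist; z \<leftarrow> uniform; w \<leftarrow> uniform; b \<leftarrow> uniform;
       map_pmf (F (hardwired h t (M, Z, W)) m z w b) (pair_pmf (coins P) (pair_pmf (pair_pmf ?md uniform) uniform))}"
    unfolding F[symmetric]
    by (simp add: hardwired_dist_def zeta_eq pair_pmf_def map_bind_pmf bind_assoc_pmf bind_return_pmf)
       (simp add: map_pmf_def)
  also have "\<dots> = do {M \<leftarrow> ?md; Z \<leftarrow> uniform; W \<leftarrow> uniform; m \<leftarrow> mode_dist; z \<leftarrow> uniform; w \<leftarrow> uniform; b \<leftarrow> uniform;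
      r \<leftarrow> coins P; m1 \<leftarrow> ?md; b1 \<leftarrow> uniform; b2 \<leftarrow> uniform;
      return_pmf (obs (sM M m m1) (Z(t := z)) (W(t := w)) (sB b2 b b1) r)}"
    unfolding key[symmetric]
    by (simp add: F_def Let_def pair_pmf_def map_bind_pmf bind_assoc_pmf bind_return_pmf)
  also have "\<dots> = do {M \<leftarrow> ?md; m \<leftarrow> mode_dist; m1 \<leftarrow> ?md; Z \<leftarrow> uniform; z \<leftarrow> uniform; W \<leftarrow> uniform; w \<leftarrow> uniform;
      b2 \<leftarrow> uniform; b \<leftarrow> uniform; b1 \<leftarrow> uniform; r \<leftarrow> coins P;
      return_pmf (obs (sM M m m1) (Z(t := z)) (W(t := w)) (sB b2 b b1) r)}"
    by (rule bind_pmf_reorder)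
  \<comment> \<open>Each group of draws feeds one variable and splices back to the original
    distribution of that variable.\<close>
  also have "\<dots> = do {m \<leftarrow> do {M \<leftarrow> ?md; m \<leftarrow> mode_dist; m1 \<leftarrow> ?md; return_pmf (sM M m m1)};
      z \<leftarrow> do {Z \<leftarrow> uniform; z \<leftarrow> uniform; return_pmf (Z(t := z))};
      w \<leftarrow> do {W \<leftarrow> uniform; w \<leftarrow> uniform; return_pmf (W(t := w))};
      b \<leftarrow> do {b2 \<leftarrow> uniform; b \<leftarrow> uniform; b1 \<leftarrow> uniform; return_pmf (sB b2 b b1)};
      r \<leftarrow> coins P; return_pmf (obs m z w b r)}"
    by (simp add: bind_assoc_pmf bind_return_pmf)
  also have "\<dots> = do {m \<leftarrow> ?md; z \<leftarrow> uniform; w \<leftarrow> uniform; b \<leftarrow> uniform; r \<leftarrow> coins P; return_pmf (obs m z w b r)}"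
    unfolding sM_def sB_def by (simp only: Pi_pmf_splice3[of undefined "\<lambda>_. mode_dist" t A, symmetric] uniform_resample[symmetric] uniform_splice3[symmetric])
  also have "\<dots> = map_pmf (\<lambda>((x, m, z, w), r). (hardwired h t (m, z, w), \<lambda>j. x i (t, j), m t, z t, w t,
        prefix_queries (later h t (x i)) (view i (transcript P x r)))) (pair_pmf zeta_power (coins P))"
    by (simp add: zeta_power_eq pair_pmf_def map_bind_pmf bind_assoc_pmf bind_return_pmf obs_def Let_def)
  finally show ?thesis .
qed

section \<open>Additivity of the information cost\<close>

lemma info_cost_eq:
  "info_cost \<mu> P = (\<Sum>i\<in>UNIV.
    cond_mutual_info (pair_pmf \<mu> (coins P)) (\<lambda>((x, m, z, w), r). x i)
      (\<lambda>((x, m, z, w), r). view i (transcript P x r)) (\<lambda>((x, m, z, w), r). (m, z, w)) +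
    cond_mutual_info (pair_pmf \<mu> (coins P)) (\<lambda>((x, m, z, w), r). m)
      (\<lambda>((x, m, z, w), r). view i (transcript P x r)) (\<lambda>((x, m, z, w), r). (x i, z, w)))"
  unfolding info_cost_def Let_def by (simp add: case_prod_unfold)

lemma finite_range_view_case:
  assumes "bounded_comm P"
  shows "finite (range (\<lambda>((x, m, z, w), r). view i (transcript P x r)))"
  using finite_range_view[OF assms, of i "\<lambda>s. fst (fst s)" snd] by (simp add: case_prod_unfold)

lemma info_cost_nonneg:
  fixes P :: "('k::finite, 'a::finite) protocol"
    and \<mu> :: "(('k \<Rightarrow> 'a) \<times> 'b::finite \<times> 'c::finite \<times> 'd::finite) pmf"
  assumes "bounded_comm P"
  shows "0 \<le> info_cost \<mu> P"
  unfolding info_cost_eq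
  by (intro sum_nonneg add_nonneg_nonneg cond_mutual_info_nonneg finite_range_view_case[OF assms]) simp_all

text \<open>A real infimum is guaranteed to be a lower bound only for a set bounded below;
  nonnegativity of the cost supplies the bound 0.\<close>

lemma info_complexity_le:
  fixes P :: "('k::finite, 'a::finite) protocol"
    and \<mu> :: "(('k \<Rightarrow> 'a) \<times> 'b::finite \<times> 'c::finite \<times> 'd::finite) pmf"
  assumes "error_protocol \<delta> f P"
  shows "info_complexity \<delta> \<mu> f \<le> info_cost \<mu> P"
  unfolding info_complexity_def
proof (rule cINF_lower)
  show "bdd_below (info_cost \<mu> ` {P. error_protocol \<delta> f P})"
    by (rule bdd_belowI[of _ 0]) (auto simp: error_protocol_def intro: info_cost_nonneg)
qed (use assms in simp)

section \<open>Entropies with part of the blocks revealed\<close>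

text \<open>Two sets of blocks index the entropies of the argument: where the row of
  \<open>i\<close> is known and where \<open>M\<close> is. \<open>option\<close> keeps a hidden
  entry apart from a known one; \<open>Z\<close> and \<open>W\<close> are always known.\<close>

definition revealed :: "'k \<Rightarrow> 'm set \<Rightarrow> 'm set \<Rightarrow> ('k \<Rightarrow> 'm \<times> 'l \<Rightarrow> bool) \<times> ('k, 'm, 'l) aux \<Rightarrow>
    ('m \<Rightarrow> ('l \<Rightarrow> bool) option) \<times> ('m \<Rightarrow> ('l \<Rightarrow> bool) option) \<times> ('m \<Rightarrow> 'l \<Rightarrow> 'k) \<times> ('m \<Rightarrow> 'l)" where
  "revealed i S T = (\<lambda>(x, m, z, w). (\<lambda>t. if t \<in> S then Some (\<lambda>j. x i (t, j)) else None,
     \<lambda>t. if t \<in> T then Some (m t) else None, z, w))"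

lemma revealed_eq_iff:
  "revealed i S T (x, m, z, w) = revealed i S T (x', m', z', w') \<longleftrightarrow>
    (\<forall>t\<in>S. (\<lambda>j. x i (t, j)) = (\<lambda>j. x' i (t, j))) \<and> (\<forall>t\<in>T. m t = m' t) \<and> z = z' \<and> w = w'"
  unfolding revealed_def by (auto simp: fun_eq_iff split: if_splits)

lemma hardwired_eq_iff:
  "hardwired h t (m, z, w) = hardwired h t (m', z', w') \<longleftrightarrow>
    (\<forall>t'. h t' < h t \<longrightarrow> m t' = m' t') \<and> (\<forall>t'. t' \<noteq> t \<longrightarrow> z t' = z' t') \<and> (\<forall>t'. t' \<noteq> t \<longrightarrow> w t' = w' t')"
  unfolding hardwired_def by (auto simp: fun_eq_iff split: if_splits)

abbreviation joint :: "('k::finite, 'm::finite \<times> 'l::finite \<Rightarrow> bool) protocol \<Rightarrow>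
    ((('k \<Rightarrow> 'm \<times> 'l \<Rightarrow> bool) \<times> ('k, 'm, 'l) aux) \<times> 'k coins) pmf" where
  "joint P \<equiv> pair_pmf zeta_power (coins P)"

definition revealed_ent :: "('k::finite, 'm::finite \<times> 'l::finite \<Rightarrow> bool) protocol \<Rightarrow> 'k \<Rightarrow> 'm set \<Rightarrow> 'm set \<Rightarrow> real" where
  "revealed_ent P i S T = ent (map_pmf (\<lambda>(a, r). revealed i S T a) (joint P))"

definition revealed_view_ent :: "('k::finite, 'm::finite \<times> 'l::finite \<Rightarrow> bool) protocol \<Rightarrow> 'k \<Rightarrow> 'm set \<Rightarrow> 'm set \<Rightarrow> real" where
  "revealed_view_ent P i S T = ent (map_pmf (\<lambda>(a, r). (revealed i S T a, view i (transcript P (fst a) r))) (joint P))"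

text \<open>The \<open>itself\<close> argument fixes the column type \<open>'l\<close>, which the
  other arguments do not mention.\<close>

definition block_ent :: "'k::finite \<Rightarrow> bool \<Rightarrow> bool \<Rightarrow> 'l::finite itself \<Rightarrow> real" where
  "block_ent i s t _ = ent (map_pmf (\<lambda>(x, m, z, w). (if s then Some (x i) else None, if t then Some m else None, z, w))
     (zeta :: (('k \<Rightarrow> 'l \<Rightarrow> bool) \<times> ('l \<Rightarrow> bool) \<times> ('l \<Rightarrow> 'k) \<times> 'l) pmf))"

text \<open>Modularity in \<open>S\<close> and \<open>T\<close> encodes the independence of the blocks.\<close>

lemma revealed_ent_eq_sum:
  fixes P :: "('k::finite, 'm::finite \<times> 'l::finite \<Rightarrow> bool) protocol"
  shows "revealed_ent P i S T = (\<Sum>t\<in>UNIV. block_ent i (t \<in> S) (t \<in> T) TYPE('l))"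
proof -
  let ?f = "\<lambda>t (x, m, z, w). (if t \<in> S then Some (x i) else None, if t \<in> T then Some m else None, z, w)"
  let ?z = "zeta :: (('k \<Rightarrow> 'l \<Rightarrow> bool) \<times> ('l \<Rightarrow> bool) \<times> ('l \<Rightarrow> 'k) \<times> 'l) pmf"
  let ?join = "\<lambda>s. (\<lambda>i (t, j). fst (s t) i j, \<lambda>t. fst (snd (s t)), \<lambda>t. fst (snd (snd (s t))), \<lambda>t. snd (snd (snd (s t))))"
  have "map_pmf (\<lambda>(a, r). revealed i S T a) (joint P) = map_pmf (revealed i S T) (map_pmf fst (joint P))"
    by (simp only: pmf.map_comp o_def case_prod_unfold)
  then have "revealed_ent P i S T = ent (map_pmf (\<lambda>s. revealed i S T (?join s)) (Pi_pmf UNIV undefined (\<lambda>_. ?z)))"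
    unfolding revealed_ent_def map_fst_pair_pmf
    by (simp add: zeta_power_def map_bind_pmf) (simp add: map_pmf_def)
  also have "\<dots> = ent (map_pmf (\<lambda>s t. ?f t (s t)) (Pi_pmf UNIV undefined (\<lambda>_. ?z)))"
  proof (rule ent_map_cong)
    fix s s' :: "'m \<Rightarrow> ('k \<Rightarrow> 'l \<Rightarrow> bool) \<times> ('l \<Rightarrow> bool) \<times> ('l \<Rightarrow> 'k) \<times> 'l"
    have "(\<lambda>t. ?f t (s t)) = (\<lambda>t. ?f t (s' t)) \<longleftrightarrow>
      (\<forall>t. (t \<in> S \<longrightarrow> fst (s t) i = fst (s' t) i) \<and> (t \<in> T \<longrightarrow> fst (snd (s t)) = fst (snd (s' t))) \<and>
        fst (snd (snd (s t))) = fst (snd (snd (s' t))) \<and> snd (snd (snd (s t))) = snd (snd (snd (s' t))))"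
      unfolding fun_eq_iff[of "\<lambda>t. ?f t (s t)" "\<lambda>t. ?f t (s' t)"] by (intro iff_allI) (auto simp: case_prod_unfold prod_eq_iff)
    then show "revealed i S T (?join s) = revealed i S T (?join s') \<longleftrightarrow> (\<lambda>t. ?f t (s t)) = (\<lambda>t. ?f t (s' t))"
      unfolding revealed_eq_iff by (auto simp: fun_eq_iff)
  qed
  also have "\<dots> = ent (Pi_pmf UNIV undefined (\<lambda>t. map_pmf (?f t) ?z))"
    by (rule arg_cong[OF map_pmf_Pi_pmf_UNIV[of ?f]])
  also have "\<dots> = (\<Sum>t\<in>UNIV. ent (map_pmf (?f t) ?z))"
    by (rule ent_Pi_pmf) simp_all
  finally show ?thesis
    by (simp add: block_ent_def)
qed

text \<open>Only the summand of \<open>t\<close> changes, so what the row of \<open>t\<close> adds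
  depends on whether \<open>M\<close> is known in \<open>t\<close> and on no other block. This
  replaces an appeal to conditional independence.\<close>

lemma revealed_ent_insert_input:
  fixes P :: "('k::finite, 'm::finite \<times> 'l::finite \<Rightarrow> bool) protocol"
  assumes "t \<notin> S"
  shows "revealed_ent P i (insert t S) T - revealed_ent P i S T =
    block_ent i True (t \<in> T) TYPE('l) - block_ent i False (t \<in> T) TYPE('l)"
proof -
  have "(\<Sum>t'\<in>UNIV. block_ent i (t' \<in> insert t S) (t' \<in> T) TYPE('l)) - (\<Sum>t'\<in>UNIV. block_ent i (t' \<in> S) (t' \<in> T) TYPE('l)) =
    (\<Sum>t'\<in>UNIV. if t' = t then block_ent i True (t \<in> T) TYPE('l) - block_ent i False (t \<in> T) TYPE('l) else 0)"
    unfolding sum_subtractf[symmetric] using assms by (intro sum.cong) auto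
  then show ?thesis
    by (simp add: revealed_ent_eq_sum)
qed

lemma revealed_ent_insert_mode:
  fixes P :: "('k::finite, 'm::finite \<times> 'l::finite \<Rightarrow> bool) protocol"
  assumes "t \<notin> T"
  shows "revealed_ent P i S (insert t T) - revealed_ent P i S T =
    block_ent i (t \<in> S) True TYPE('l) - block_ent i (t \<in> S) False TYPE('l)"
proof -
  have "(\<Sum>t'\<in>UNIV. block_ent i (t' \<in> S) (t' \<in> insert t T) TYPE('l)) - (\<Sum>t'\<in>UNIV. block_ent i (t' \<in> S) (t' \<in> T) TYPE('l)) =
    (\<Sum>t'\<in>UNIV. if t' = t then block_ent i (t \<in> S) True TYPE('l) - block_ent i (t \<in> S) False TYPE('l) else 0)"
    unfolding sum_subtractf[symmetric] using assms by (intro sum.cong) auto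
  then show ?thesis
    by (simp add: revealed_ent_eq_sum)
qed

context
  fixes P :: "('k::finite, 'm::finite \<times> 'l::finite \<Rightarrow> bool) protocol" and i :: 'k
  assumes P: "bounded_comm P"
begin

abbreviation "proc_view \<equiv> (\<lambda>((x, m, z, w), r). view i (transcript P x r))"

lemma ent_joint_eq_revealed:
  assumes "\<And>x m z w r x' m' z' w' r'.
    F ((x, m, z, w), r) = F ((x', m', z', w'), r') \<longleftrightarrow> revealed i S T (x, m, z, w) = revealed i S T (x', m', z', w')"
  shows "ent (map_pmf F (joint P)) = revealed_ent P i S T"
  unfolding revealed_ent_def using assms by (intro ent_map_cong) auto

lemma ent_joint_eq_revealed_view:
  assumes "\<And>x m z w r x' m' z' w' r'.
    F ((x, m, z, w), r) = F ((x', m', z', w'), r') \<longleftrightarrow> revealed i S T (x, m, z, w) = revealed i S T (x', m', z', w') \<and>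
      view i (transcript P x r) = view i (transcript P x' r')"
  shows "ent (map_pmf F (joint P)) = revealed_view_ent P i S T"
  unfolding revealed_view_ent_def using assms by (intro ent_map_cong) auto

text \<open>Each bracket is minus the conditional entropy of the view given what is revealed. The
  information is thus a difference of two values of one set function, which can be
  telescoped.\<close>

lemma input_info_eq:
  "cond_mutual_info (joint P) (\<lambda>((x, m, z, w), r). x i) proc_view (\<lambda>((x, m, z, w), r). (m, z, w)) =
    (revealed_ent P i UNIV UNIV - revealed_view_ent P i UNIV UNIV) - (revealed_ent P i {} UNIV - revealed_view_ent P i {} UNIV)"
proof -
  have x: "(\<forall>t. (\<lambda>j. x i (t, j)) = (\<lambda>j. x' i (t, j))) \<longleftrightarrow> x i = x' i" for x x' :: "'k \<Rightarrow> 'm \<times> 'l \<Rightarrow> bool"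
    by (auto simp: fun_eq_iff)
  show ?thesis
    apply (subst cond_mutual_info_eq_ent[OF _ finite_range_view_case[OF P]], simp, simp)
    apply (subst ent_joint_eq_revealed[where S = UNIV and T = UNIV], (auto simp: revealed_eq_iff x)[])
    apply (subst ent_joint_eq_revealed_view[where S = "{}" and T = UNIV], (auto simp: revealed_eq_iff)[])
    apply (subst ent_joint_eq_revealed_view[where S = UNIV and T = UNIV], (auto simp: revealed_eq_iff x)[])
    apply (subst ent_joint_eq_revealed[where S = "{}" and T = UNIV], (auto simp: revealed_eq_iff)[])
    apply simp
    done
qed

lemma mode_info_eq:
  "cond_mutual_info (joint P) (\<lambda>((x, m, z, w), r). m) proc_view (\<lambda>((x, m, z, w), r). (x i, z, w)) =
    (revealed_ent P i UNIV UNIV - revealed_view_ent P i UNIV UNIV) - (revealed_ent P i UNIV {} - revealed_view_ent P i UNIV {})"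
proof -
  have x: "(\<forall>t. (\<lambda>j. x i (t, j)) = (\<lambda>j. x' i (t, j))) \<longleftrightarrow> x i = x' i" for x x' :: "'k \<Rightarrow> 'm \<times> 'l \<Rightarrow> bool"
    by (auto simp: fun_eq_iff)
  show ?thesis
    apply (subst cond_mutual_info_eq_ent[OF _ finite_range_view_case[OF P]], simp, simp)
    apply (subst ent_joint_eq_revealed[where S = UNIV and T = UNIV], (auto simp: revealed_eq_iff x)[])
    apply (subst ent_joint_eq_revealed_view[where S = UNIV and T = "{}"], (auto simp: revealed_eq_iff x)[])
    apply (subst ent_joint_eq_revealed_view[where S = UNIV and T = UNIV], (auto simp: revealed_eq_iff x)[])
    apply (subst ent_joint_eq_revealed[where S = UNIV and T = "{}"], (auto simp: revealed_eq_iff x)[])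
    apply simp
    done
qed

lemma bounded_comm_embed: "bounded_comm (embed h t d P)"
  unfolding embed_def by (rule bounded_comm_simulate[OF length_advice P])

lemma finite_range_revealed_view:
  "finite (range (\<lambda>((x, m, z, w), r). (revealed i S T (x, m, z, w), view i (transcript P x r))))"
  using finite_range_Pair[OF finite[of "range (\<lambda>((x, m, z, w), r). revealed i S T (x, m, z, w))"]
      finite_range_view_case[OF P, of i]]
  by (simp add: case_prod_unfold)

lemma finite_range_prefix_queries:
  "finite (range (\<lambda>((x, m, z, w), r). prefix_queries (later h t (x i)) (view i (transcript P x r))))"
  using finite_imageI[OF finite_range_Pair[OF finite[of "range (\<lambda>((x, m, z, w), r). later h t (x i))"]
      finite_range_view_case[OF P, of i]], of "\<lambda>(u, v). prefix_queries u v"]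
  by (simp add: image_image case_prod_unfold)

lemma later_revealed:
  assumes "{t'. h t < h t'} \<subseteq> S"
  shows "(\<lambda>(t', j). h t < h t' \<and> the (fst (revealed i S T (x, m, z, w)) t') j) = later h t (x i)"
  using assms by (auto simp: later_def revealed_def fun_eq_iff)

section \<open>Information cost of the embedding at one block\<close>

text \<open>Averaging over the hard-wired values conditions on them and leaves, in \<open>P\<close>,
  the information between row \<open>t\<close> and the prefixed view. The bound is the change in
  minus the conditional entropy of the view when \<open>t\<close> joins the revealed rows.\<close>

lemma input_info_embed_le:
  assumes h: "inj h"
  shows "(\<Sum>d\<in>UNIV. pmf (hardwired_dist h t) d *
      cond_mutual_info (pair_pmf zeta (coins (embed h t d P))) (\<lambda>((x, m, z, w), r). x i)
        (\<lambda>((x, m, z, w), r). view i (transcript (embed h t d P) x r)) (\<lambda>((x, m, z, w), r). (m, z, w)))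
    \<le> (revealed_ent P i {t'. h t \<le> h t'} UNIV - revealed_view_ent P i {t'. h t \<le> h t'} UNIV)
      - (revealed_ent P i {t'. h t < h t'} UNIV - revealed_view_ent P i {t'. h t < h t'} UNIV)"
proof -
  let ?X = "\<lambda>((x, m, z, w), r). \<lambda>j. x i (t, j)"
  let ?V = "\<lambda>((x, m, z, w), r). prefix_queries (later h t (x i)) (view i (transcript P x r))"
  let ?R = "\<lambda>((x, m, z, w), r). (revealed i {t'. h t < h t'} UNIV (x, m, z, w), view i (transcript P x r))"
  let ?C = "\<lambda>((x, m, z, w), r). (hardwired h t (m, z, w), m t, z t, w t)"
  have le: "{t'. h t' \<le> h t} = insert t {t'. h t' < h t}" and ge: "{t'. h t \<le> h t'} = insert t {t'. h t < h t'}"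
    using injD[OF h] by (auto simp: le_less)
  \<comment> \<open>\<open>hardwired\<close> keeps \<open>Z\<close> and \<open>W\<close> away from
    \<open>t\<close>; together with their values at \<open>t\<close> they are known
    completely.\<close>
  have upd: "f t = g t \<Longrightarrow> (\<forall>t'. t' \<noteq> t \<longrightarrow> f t' = g t') \<longleftrightarrow> f = g" for f g :: "'m \<Rightarrow> 'z"
    by (auto simp: fun_eq_iff)
  have "(\<Sum>d\<in>UNIV. pmf (hardwired_dist h t) d *
      cond_mutual_info (pair_pmf zeta (coins (embed h t d P))) (\<lambda>((x, m, z, w), r). x i)
        (\<lambda>((x, m, z, w), r). view i (transcript (embed h t d P) x r)) (\<lambda>((x, m, z, w), r). (m, z, w))) =
      cond_mutual_info (bind_pmf (hardwired_dist h t) (\<lambda>d. map_pmf (Pair d) (pair_pmf zeta (coins (embed h t d P)))))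
        (\<lambda>(d, (x, m, z, w), r). x i) (\<lambda>(d, (x, m, z, w), r). view i (transcript (embed h t d P) x r))
        (\<lambda>(d, s). (d, (\<lambda>((x, m, z, w), r). (m, z, w)) s))"
    by (rule sum_cond_mutual_info) (simp_all add: finite_range_view_case[OF bounded_comm_embed])
  also have "\<dots> = cond_mutual_info (joint P) ?X ?V ?C"
  proof (rule cond_mutual_info_cong_law)
    show "finite (range (\<lambda>(d, (x, m, z, w), r). view i (transcript (embed h t d P) x r)))"
      by (rule finite_range_case_prod[OF finite_range_view_case[OF bounded_comm_embed]])
    show "map_pmf (\<lambda>s. ((\<lambda>(d, (x, m, z, w), r). x i) s, (\<lambda>(d, (x, m, z, w), r). view i (transcript (embed h t d P) x r)) s,
         (\<lambda>(d, s). (d, (\<lambda>((x, m, z, w), r). (m, z, w)) s)) s))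
         (bind_pmf (hardwired_dist h t) (\<lambda>d. map_pmf (Pair d) (pair_pmf zeta (coins (embed h t d P))))) =
      map_pmf (\<lambda>s. (?X s, ?V s, ?C s)) (joint P)"
      using arg_cong[OF bind_zeta_embed[OF h, of t i P], of "map_pmf (\<lambda>(d, x, m, z, w, v). (x, v, d, m, z, w))"]
      by (simp add: map_bind_pmf pmf.map_comp o_def case_prod_unfold)
  qed (simp_all add: finite_range_prefix_queries)
  also have "\<dots> = cond_mutual_info (joint P) ?X
      (\<lambda>s. (\<lambda>(k, v). prefix_queries (\<lambda>(t', j). h t < h t' \<and> the (fst k t') j) v) (?R s)) ?C"
    by (rule arg_cong[where f = "\<lambda>V. cond_mutual_info (joint P) ?X V ?C"], rule ext)
       (clarsimp simp: later_revealed[OF subset_refl])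
  \<comment> \<open>The prefixed view is a function of the later rows and the view. It need not
    determine them, for instance when processor \<open>i\<close> is never queried.\<close>
  also have "\<dots> \<le> cond_mutual_info (joint P) ?X ?R ?C"
    by (rule cond_mutual_info_data_processing) (simp_all add: finite_range_revealed_view)
  also have "\<dots> = revealed_ent P i {t} {t'. h t' \<le> h t} + revealed_view_ent P i {t'. h t < h t'} UNIV
      - revealed_view_ent P i {t'. h t \<le> h t'} UNIV - revealed_ent P i {} {t'. h t' \<le> h t}"
  proof -
    have "ent (map_pmf (\<lambda>s. (?X s, ?C s)) (joint P)) = revealed_ent P i {t} {t'. h t' \<le> h t}"
      by (rule ent_joint_eq_revealed) (auto simp: revealed_eq_iff hardwired_eq_iff le upd)
    moreover have "ent (map_pmf (\<lambda>s. (?R s, ?C s)) (joint P)) = revealed_view_ent P i {t'. h t < h t'} UNIV"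
      by (rule ent_joint_eq_revealed_view) (auto simp: revealed_eq_iff hardwired_eq_iff)
    moreover have "ent (map_pmf (\<lambda>s. (?X s, ?R s, ?C s)) (joint P)) = revealed_view_ent P i {t'. h t \<le> h t'} UNIV"
      by (rule ent_joint_eq_revealed_view) (auto simp: revealed_eq_iff hardwired_eq_iff ge)
    moreover have "ent (map_pmf ?C (joint P)) = revealed_ent P i {} {t'. h t' \<le> h t}"
      by (rule ent_joint_eq_revealed) (auto simp: revealed_eq_iff hardwired_eq_iff le upd)
    ultimately show ?thesis
      by (subst cond_mutual_info_eq_ent) (simp_all add: finite_range_revealed_view)
  qed
  \<comment> \<open>Independence of the blocks: row \<open>t\<close> adds the same entropy with or
    without the later rows and the later \<open>M\<close>, so these may move into the
    condition.\<close>
  also have "revealed_ent P i {t} {t'. h t' \<le> h t} - revealed_ent P i {} {t'. h t' \<le> h t} =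
      revealed_ent P i {t'. h t \<le> h t'} UNIV - revealed_ent P i {t'. h t < h t'} UNIV"
    unfolding ge by (simp add: revealed_ent_insert_input)
  then have "revealed_ent P i {t} {t'. h t' \<le> h t} + revealed_view_ent P i {t'. h t < h t'} UNIV
      - revealed_view_ent P i {t'. h t \<le> h t'} UNIV - revealed_ent P i {} {t'. h t' \<le> h t} =
      (revealed_ent P i {t'. h t \<le> h t'} UNIV - revealed_view_ent P i {t'. h t \<le> h t'} UNIV)
      - (revealed_ent P i {t'. h t < h t'} UNIV - revealed_view_ent P i {t'. h t < h t'} UNIV)"
    by simp
  finally show ?thesis .
qed

text \<open>Here all rows of processor \<open>i\<close> are revealed along with the view, but
  \<open>M\<close> only before \<open>t\<close>, since the later values of \<open>M\<close> are not
  hard-wired. The bound is the change when \<open>t\<close> joins the revealed part of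
  \<open>M\<close>.\<close>

lemma mode_info_embed_le:
  assumes h: "inj h"
  shows "(\<Sum>d\<in>UNIV. pmf (hardwired_dist h t) d *
      cond_mutual_info (pair_pmf zeta (coins (embed h t d P))) (\<lambda>((x, m, z, w), r). m)
        (\<lambda>((x, m, z, w), r). view i (transcript (embed h t d P) x r)) (\<lambda>((x, m, z, w), r). (x i, z, w)))
    \<le> (revealed_ent P i UNIV {t'. h t' \<le> h t} - revealed_view_ent P i UNIV {t'. h t' \<le> h t})
      - (revealed_ent P i UNIV {t'. h t' < h t} - revealed_view_ent P i UNIV {t'. h t' < h t})"
proof -
  let ?M = "\<lambda>((x, m, z, w), r). m t"
  let ?V = "\<lambda>((x, m, z, w), r). prefix_queries (later h t (x i)) (view i (transcript P x r))"
  let ?R = "\<lambda>((x, m, z, w), r). (revealed i UNIV {t'. h t' < h t} (x, m, z, w), view i (transcript P x r))"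
  let ?C = "\<lambda>((x, m, z, w), r). (hardwired h t (m, z, w), \<lambda>j. x i (t, j), z t, w t)"
  have le: "{t'. h t' \<le> h t} = insert t {t'. h t' < h t}"
    using injD[OF h] by (auto simp: le_less)
  have upd: "f t = g t \<Longrightarrow> (\<forall>t'. t' \<noteq> t \<longrightarrow> f t' = g t') \<longleftrightarrow> f = g" for f g :: "'m \<Rightarrow> 'z"
    by (auto simp: fun_eq_iff)
  have "(\<Sum>d\<in>UNIV. pmf (hardwired_dist h t) d *
      cond_mutual_info (pair_pmf zeta (coins (embed h t d P))) (\<lambda>((x, m, z, w), r). m)
        (\<lambda>((x, m, z, w), r). view i (transcript (embed h t d P) x r)) (\<lambda>((x, m, z, w), r). (x i, z, w))) =
      cond_mutual_info (bind_pmf (hardwired_dist h t) (\<lambda>d. map_pmf (Pair d) (pair_pmf zeta (coins (embed h t d P)))))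
        (\<lambda>(d, (x, m, z, w), r). m) (\<lambda>(d, (x, m, z, w), r). view i (transcript (embed h t d P) x r))
        (\<lambda>(d, s). (d, (\<lambda>((x, m, z, w), r). (x i, z, w)) s))"
    by (rule sum_cond_mutual_info) (simp_all add: finite_range_view_case[OF bounded_comm_embed])
  also have "\<dots> = cond_mutual_info (joint P) ?M ?V ?C"
  proof (rule cond_mutual_info_cong_law)
    show "finite (range (\<lambda>(d, (x, m, z, w), r). view i (transcript (embed h t d P) x r)))"
      by (rule finite_range_case_prod[OF finite_range_view_case[OF bounded_comm_embed]])
    show "map_pmf (\<lambda>s. ((\<lambda>(d, (x, m, z, w), r). m) s, (\<lambda>(d, (x, m, z, w), r). view i (transcript (embed h t d P) x r)) s,
         (\<lambda>(d, s). (d, (\<lambda>((x, m, z, w), r). (x i, z, w)) s)) s))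
         (bind_pmf (hardwired_dist h t) (\<lambda>d. map_pmf (Pair d) (pair_pmf zeta (coins (embed h t d P))))) =
      map_pmf (\<lambda>s. (?M s, ?V s, ?C s)) (joint P)"
      using arg_cong[OF bind_zeta_embed[OF h, of t i P], of "map_pmf (\<lambda>(d, x, m, z, w, v). (m, v, d, x, z, w))"]
      by (simp add: map_bind_pmf pmf.map_comp o_def case_prod_unfold)
  qed (simp_all add: finite_range_prefix_queries)
  also have "\<dots> = cond_mutual_info (joint P) ?M
      (\<lambda>s. (\<lambda>(k, v). prefix_queries (\<lambda>(t', j). h t < h t' \<and> the (fst k t') j) v) (?R s)) ?C"
    by (rule arg_cong[where f = "\<lambda>V. cond_mutual_info (joint P) ?M V ?C"], rule ext)
       (clarsimp simp: later_revealed[OF subset_UNIV])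
  also have "\<dots> \<le> cond_mutual_info (joint P) ?M ?R ?C"
    by (rule cond_mutual_info_data_processing) (simp_all add: finite_range_revealed_view)
  also have "\<dots> = revealed_ent P i {t} {t'. h t' \<le> h t} + revealed_view_ent P i UNIV {t'. h t' < h t}
      - revealed_view_ent P i UNIV {t'. h t' \<le> h t} - revealed_ent P i {t} {t'. h t' < h t}"
  proof -
    have "ent (map_pmf (\<lambda>s. (?M s, ?C s)) (joint P)) = revealed_ent P i {t} {t'. h t' \<le> h t}"
      by (rule ent_joint_eq_revealed) (auto simp: revealed_eq_iff hardwired_eq_iff le upd)
    moreover have "ent (map_pmf (\<lambda>s. (?R s, ?C s)) (joint P)) = revealed_view_ent P i UNIV {t'. h t' < h t}"
      by (rule ent_joint_eq_revealed_view) (auto simp: revealed_eq_iff hardwired_eq_iff)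
    moreover have "ent (map_pmf (\<lambda>s. (?M s, ?R s, ?C s)) (joint P)) = revealed_view_ent P i UNIV {t'. h t' \<le> h t}"
      by (rule ent_joint_eq_revealed_view) (auto simp: revealed_eq_iff hardwired_eq_iff le)
    moreover have "ent (map_pmf ?C (joint P)) = revealed_ent P i {t} {t'. h t' < h t}"
      by (rule ent_joint_eq_revealed) (auto simp: revealed_eq_iff hardwired_eq_iff upd)
    ultimately show ?thesis
      by (subst cond_mutual_info_eq_ent) (simp_all add: finite_range_revealed_view)
  qed
  \<comment> \<open>Independence again: once row \<open>t\<close> is known, \<open>M\<close> in
    block \<open>t\<close> adds the same entropy with or without the other rows.\<close>
  also have "revealed_ent P i {t} {t'. h t' \<le> h t} - revealed_ent P i {t} {t'. h t' < h t} =
      revealed_ent P i UNIV {t'. h t' \<le> h t} - revealed_ent P i UNIV {t'. h t' < h t}"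
    unfolding le by (simp add: revealed_ent_insert_mode)
  then have "revealed_ent P i {t} {t'. h t' \<le> h t} + revealed_view_ent P i UNIV {t'. h t' < h t}
      - revealed_view_ent P i UNIV {t'. h t' \<le> h t} - revealed_ent P i {t} {t'. h t' < h t} =
      (revealed_ent P i UNIV {t'. h t' \<le> h t} - revealed_view_ent P i UNIV {t'. h t' \<le> h t})
      - (revealed_ent P i UNIV {t'. h t' < h t} - revealed_view_ent P i UNIV {t'. h t' < h t})"
    by simp
  finally show ?thesis .
qed

end

section \<open>Summation over the blocks\<close>

lemma sum_bij_betw_telescope:
  fixes a :: "nat \<Rightarrow> real"
  assumes "bij_betw h UNIV {..<n}"
  shows "(\<Sum>t\<in>UNIV. a (Suc (h t)) - a (h t)) = a n - a 0"
  using sum.reindex_bij_betw[OF assms, of "\<lambda>k. a (Suc k) - a k"] by (simp add: sum_lessThan_telescope)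

text \<open>For each processor the increments telescope: rows are revealed from the last block
  backwards, \<open>M\<close> from the first block forwards. The endpoints, nothing or everything
  revealed, give the two terms in the cost of \<open>P\<close>.\<close>

lemma sum_info_cost_embed_le:
  fixes P :: "('k::finite, 'm::finite \<times> 'l::finite \<Rightarrow> bool) protocol"
  assumes P: "bounded_comm P" and h: "bij_betw h (UNIV :: 'm set) {..<n}"
  shows "(\<Sum>t\<in>UNIV. \<Sum>d\<in>UNIV. pmf (hardwired_dist h t) d * info_cost zeta (embed h t d P)) \<le> info_cost zeta_power P"
proof -
  have inj: "inj h"
    using h by (simp add: bij_betw_def)
  have hn: "h t < n" for t
    using h by (auto simp: bij_betw_def)
  let ?q = "\<lambda>t d. pair_pmf zeta (coins (embed h t d P))"
  let ?V = "\<lambda>t d i ((x, m, z, w), r). view i (transcript (embed h t d P) x r)"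
  let ?I = "\<lambda>t i d. cond_mutual_info (?q t d) (\<lambda>((x, m, z, w), r). x i) (?V t d i) (\<lambda>((x, m, z, w), r). (m, z, w))"
  let ?J = "\<lambda>t i d. cond_mutual_info (?q t d) (\<lambda>((x, m, z, w), r). m) (?V t d i) (\<lambda>((x, m, z, w), r). (x i, z, w))"
  let ?D = "\<lambda>t. pmf (hardwired_dist h t)"
  \<comment> \<open>\<open>a\<close> is a conditional entropy of the view and \<open>b\<close> minus
    one: as \<open>k\<close> grows, the set of known rows shrinks while that of known
    \<open>M\<close> grows, so opposite signs make the increments of both the required
    bounds.\<close>
  define a where "a = (\<lambda>i k. revealed_view_ent P i {t. k \<le> h t} UNIV - revealed_ent P i {t. k \<le> h t} UNIV)"
  define b where "b = (\<lambda>i k. revealed_ent P i UNIV {t. h t < k} - revealed_view_ent P i UNIV {t. h t < k})"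
  have a: "(\<Sum>d\<in>UNIV. ?D t d * ?I t i d) \<le> a i (Suc (h t)) - a i (h t)" for t i
    using input_info_embed_le[OF P inj, of t i] by (simp add: a_def Suc_le_eq)
  have b: "(\<Sum>d\<in>UNIV. ?D t d * ?J t i d) \<le> b i (Suc (h t)) - b i (h t)" for t i
    using mode_info_embed_le[OF P inj, of t i] by (simp add: b_def less_Suc_eq_le)
  have ends: "{t. n \<le> h t} = {}" "{t. h t < n} = UNIV"
    using hn by (auto simp: not_le)
  have "(\<Sum>t\<in>UNIV. \<Sum>d\<in>UNIV. ?D t d * info_cost zeta (embed h t d P)) =
      (\<Sum>t\<in>UNIV. \<Sum>d\<in>UNIV. \<Sum>i\<in>UNIV. ?D t d * ?I t i d + ?D t d * ?J t i d)"
    by (simp only: info_cost_eq sum_distrib_left distrib_left)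
  also have "\<dots> = (\<Sum>t\<in>UNIV. \<Sum>i\<in>UNIV. (\<Sum>d\<in>UNIV. ?D t d * ?I t i d) + (\<Sum>d\<in>UNIV. ?D t d * ?J t i d))"
    by (subst sum.swap) (simp only: sum.distrib)
  also have "\<dots> \<le> (\<Sum>t\<in>UNIV. \<Sum>i\<in>UNIV. (a i (Suc (h t)) - a i (h t)) + (b i (Suc (h t)) - b i (h t)))"
    by (intro sum_mono add_mono a b)
  also have "\<dots> = (\<Sum>i\<in>UNIV. (\<Sum>t\<in>UNIV. a i (Suc (h t)) - a i (h t)) + (\<Sum>t\<in>UNIV. b i (Suc (h t)) - b i (h t)))"
    by (subst sum.swap) (simp only: sum.distrib)
  also have "\<dots> = (\<Sum>i\<in>UNIV. (a i n - a i 0) + (b i n - b i 0))"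
    by (simp only: sum_bij_betw_telescope[OF h])
  also have "\<dots> = info_cost zeta_power P"
    unfolding info_cost_eq input_info_eq[OF P] mode_info_eq[OF P]
    by (intro sum.cong refl) (simp add: a_def b_def ends)
  finally show ?thesis .
qed

theorem theorem2:
  fixes \<delta> :: real
  assumes "0 \<le> \<delta>" and "\<delta> < 1 / 2"
  shows "info_complexity \<delta> zeta_power
           (Tribes :: ('k::finite \<Rightarrow> 'm::finite \<times> 'l::finite \<Rightarrow> bool) \<Rightarrow> bool)
         \<ge> real CARD('m) * info_complexity \<delta> zeta (Disj :: ('k \<Rightarrow> 'l \<Rightarrow> bool) \<Rightarrow> bool)"
proof -
  let ?c = "info_complexity \<delta> zeta (Disj :: ('k \<Rightarrow> 'l \<Rightarrow> bool) \<Rightarrow> bool)"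
  obtain h where h: "bij_betw h (UNIV :: 'm set) {..<CARD('m)}"
    using ex_bij_betw_finite_nat[OF finite[of "UNIV :: 'm set"]] by (auto simp: lessThan_atLeast0)
  have "real CARD('m) * ?c \<le> info_cost zeta_power P"
    if "error_protocol \<delta> Tribes P" for P :: "('k, 'm \<times> 'l \<Rightarrow> bool) protocol"
  proof -
    \<comment> \<open>Every choice of hard-wired values yields a valid \<open>Disj\<close> protocol,
      and the weights sum to 1, so the average cost is at least the infimum.\<close>
    have "?c \<le> (\<Sum>d\<in>UNIV. pmf (hardwired_dist h t) d * info_cost zeta (embed h t d P))" for t
    proof -
      have "?c = (\<Sum>d\<in>UNIV. pmf (hardwired_dist h t :: ('k, 'm, 'l) aux pmf) d * ?c)"
        by (simp add: sum_pmf_eq_1 flip: sum_distrib_right)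
      also have "\<dots> \<le> (\<Sum>d\<in>UNIV. pmf (hardwired_dist h t) d * info_cost zeta (embed h t d P))"
        using h that
        by (intro sum_mono mult_left_mono info_complexity_le error_protocol_embed) (auto simp: bij_betw_def)
      finally show ?thesis .
    qed
    then have "(\<Sum>t\<in>(UNIV :: 'm set). ?c) \<le> (\<Sum>t\<in>UNIV. \<Sum>d\<in>UNIV. pmf (hardwired_dist h t) d * info_cost zeta (embed h t d P))"
      by (intro sum_mono)
    also have "\<dots> \<le> info_cost zeta_power P"
      using that h by (intro sum_info_cost_embed_le) (auto simp: error_protocol_def)
    finally show ?thesis
      by simp
  qed
  moreover have "\<exists>P. error_protocol \<delta> (Tribes :: ('k \<Rightarrow> 'm \<times> 'l \<Rightarrow> bool) \<Rightarrow> bool) P"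
    using assms(1) by (rule ex_error_protocol)
  ultimately show ?thesis
    unfolding info_complexity_def[of \<delta> zeta_power] by (intro cINF_greatest) auto
qed

end
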